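(* Let $[Q,D]\in M(n,k)$ with $Q\in\mathrm{St}(n,k)$, $D\in\mathrm{Sym}^+(k)$, and let $Q_\perp\in\mathrm{St}(n,n-k)$ be such that $[Q\ \ Q_\perp]\in O(n)$. Let $V,W\in T_{[Q,D]}M(n,k)$ be written as $V=[Q_\perp B_V,T_V]$ and $W=[Q_\perp B_W,T_W]$ with $B_V,B_W\in\mathrm{Mat}(n-k,k)$ and $T_V,T_W\in\mathrm{Sym}(k)$. Then the pullback metric $h=\phi^*g^{BW(n,k)}$ on $M(n,k)$ satisfies $$h_{[Q,D]}(V,W)=\mathrm{Tr}\big(B_VDB_W^\top\big)+\mathrm{Tr}\big(\mathcal{S}_D(T_V)\,D\,\mathcal{S}_D(T_W)\big).$$ In particular, $h$ is a well-defined $O(k)$-invariant Riemannian metric on $M(n,k)$, and $\phi:(M(n,k),h)\to(\mathrm{Sym}^+(n,k),g^{BW(n,k)})$ is a Riemannian isometry.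
   Context: Notation: $\mathrm{Mat}(m,k)$ is the space of real $m\times k$ matrices; $\mathrm{Sym}(k)$ the symmetric $k\times k$ matrices; $\mathrm{Sym}^+(k)$ the symmetric positive definite ones; $\mathrm{St}(n,k)$ the Stiefel manifold of $n\times k$ matrices with orthonormal columns; $\mathrm{Sym}^+(n,k)=\{\Sigma\in\mathrm{Sym}(n):\Sigma\succeq0,\ \mathrm{rk}(\Sigma)=k\}$, a smooth submanifold of $\mathrm{Sym}(n)$. For $A\in\mathrm{Sym}^+(k)$ and $B\in\mathrm{Sym}(k)$, $\mathcal{S}_A(B)$ denotes the unique solution $C$ of the Sylvester equation $AC+CA=B$. Bures--Wasserstein metric: for $\Sigma\in\mathrm{Sym}^+(n,k)$, let $P_\Sigma^\perp$ be the orthogonal projector onto the nullspace of $\Sigma$ and $\Sigma^\dagger$ the Moore--Penrose inverse. Then $T_\Sigma\mathrm{Sym}^+(n,k)=\{V\in\mathrm{Sym}(n):P_\Sigma^\perp VP_\Sigma^\perp=0\}$. Writing $\Sigma=QDQ^\top$ with $Q\in\mathrm{St}(n,k)$ and $D$ positive definite (diagonal), put $\mathtt{S}_{\Sigma,V}=Q\,\mathcal{S}_D(Q^\top VQ)\,Q^\top$ (this is independent of the decomposition). The metric is $$g_\Sigma^{BW(n,k)}(V,W)=\mathrm{Tr}(\mathtt{S}_{\Sigma,V}\,\Sigma\,\mathtt{S}_{\Sigma,W})+\mathrm{Tr}(P_\Sigma^\perp V\Sigma^\dagger W).$$ $M(n,k)=\big(\mathrm{St}(n,k)\times\mathrm{Sym}^+(k)\big)/O(k)$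 is the quotient manifold by the free proper right action $(Q,D)\cdot G=(QG,G^\top DG)$, with classes $[Q,D]$, and $\phi:M(n,k)\to\mathrm{Sym}^+(n,k)$, $\phi([Q,D])=QDQ^\top$, is a diffeomorphism. The pullback metric is $h_x(V,W)=g^{BW(n,k)}_{\phi(x)}(d\phi_x V,d\phi_x W)$. Tangent vectors of $M(n,k)$: $T_{[Q,D]}M(n,k)$ is the quotient of $T_Q\mathrm{St}(n,k)\times\mathrm{Sym}(k)$ by the subspace $\{(QA,-(AD-DA)): A\in\mathrm{Mat}(k,k),\ A^\top=-A\}$, and $[V,T]$ denotes the class of $(V,T)$, i.e. its image under the differential at $(Q,D)$ of the quotient map. Given $Q_\perp$, every tangent vector at $[Q,D]$ has a unique representative of the form $(Q_\perp B,T)$ with $B\in\mathrm{Mat}(n-k,k)$, $T\in\mathrm{Sym}(k)$. $O(k)$-invariance means that the expression for $h$ does not change when $(Q,D)$ is replaced by $(QG,G^\top DG)$ and the tangent representatives $(Q_\perp B,T)$ by $(Q_\perp BG,G^\top TG)$, $G\in O(k)$. *)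

theory Defs
  imports "HOL-Analysis.Analysis"
begin

text \<open>
  Mat(m,k) is \<open>real ^ 'k ^ 'm\<close>, with m = \<open>CARD('m)\<close> and k = \<open>CARD('k)\<close>.
\<close>

section \<open>Smooth maps\<close>

primrec Cr_on :: "nat \<Rightarrow> 'a::real_normed_vector set \<Rightarrow> ('a \<Rightarrow> 'b::real_normed_vector) \<Rightarrow> bool" where
  "Cr_on 0 U f \<longleftrightarrow> continuous_on U f"
| "Cr_on (Suc r) U f \<longleftrightarrow>
     (\<forall>x\<in>U. f differentiable (at x)) \<and> (\<forall>v. Cr_on r U (\<lambda>x. frechet_derivative f (at x) v))"

text \<open>
  On an arbitrary subset, in particular on an embedded submanifold, smoothness means the existence
  of local extensions that are smooth on open sets of the ambient space.
\<close>

definition smooth_on :: "'a::euclidean_space set \<Rightarrow> ('a \<Rightarrow> 'b::euclidean_space) \<Rightarrow> bool" where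
  "smooth_on S f \<longleftrightarrow>
     (\<forall>p\<in>S. \<exists>U g. open U \<and> p \<in> U \<and> (\<forall>r. Cr_on r U g) \<and> (\<forall>x\<in>U \<inter> S. g x = f x))"

section \<open>Spaces of matrices\<close>

definition sym_mats :: "(real ^ 'k ^ 'k) set" where
  "sym_mats = {A. transpose A = A}"

definition spd_mats :: "(real ^ 'k ^ 'k) set" where
  "spd_mats = {A \<in> sym_mats. \<forall>x. x \<noteq> 0 \<longrightarrow> x \<bullet> (A *v x) > 0}"

definition spsd_rank :: "nat \<Rightarrow> (real ^ 'n ^ 'n) set" where
  "spsd_rank r = {A \<in> sym_mats. (\<forall>x. x \<bullet> (A *v x) \<ge> 0) \<and> rank A = r}"

definition stiefel :: "(real ^ 'k ^ 'n) set" where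
  "stiefel = {Q. transpose Q ** Q = mat 1}"

definition diagonal_mat :: "real ^ 'k ^ 'k \<Rightarrow> bool" where
  "diagonal_mat D \<longleftrightarrow> (\<forall>i j. i \<noteq> j \<longrightarrow> D $ i $ j = 0)"

definition hcat :: "real ^ 'k ^ 'n \<Rightarrow> real ^ 'm ^ 'n \<Rightarrow> real ^ ('k + 'm) ^ 'n" where
  "hcat A B = (\<chi> i j. case j of Inl a \<Rightarrow> A $ i $ a | Inr b \<Rightarrow> B $ i $ b)"

text \<open>
  Membership in the orthogonal group for a matrix whose rows and columns are indexed by different
  types; for a single index type it is the library's \<^const>\<open>orthogonal_matrix\<close>.
\<close>

definition orthogonal_mat2 :: "real ^ 'i ^ 'n \<Rightarrow> bool" where
  "orthogonal_mat2 U \<longleftrightarrow> transpose U ** U = mat 1 \<and> U ** transpose U = mat 1"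

section \<open>The Bures--Wasserstein metric on matrices of fixed rank\<close>

definition sylvester :: "real ^ 'k ^ 'k \<Rightarrow> real ^ 'k ^ 'k \<Rightarrow> real ^ 'k ^ 'k" where
  "sylvester A B = (THE C. A ** C + C ** A = B)"

definition null_projector :: "real ^ 'n ^ 'n \<Rightarrow> real ^ 'n ^ 'n" where
  "null_projector A =
     (THE P. \<forall>x. A *v (P *v x) = 0 \<and> (\<forall>y. A *v y = 0 \<longrightarrow> (x - P *v x) \<bullet> y = 0))"

definition moore_penrose :: "real ^ 'n ^ 'n \<Rightarrow> real ^ 'n ^ 'n" where
  "moore_penrose A =
     (THE X. A ** X ** A = A \<and> X ** A ** X = X \<and>
             transpose (A ** X) = A ** X \<and> transpose (X ** A) = X ** A)"

definition bw_tangent :: "real ^ 'n ^ 'n \<Rightarrow> (real ^ 'n ^ 'n) set" where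
  "bw_tangent A = {V \<in> sym_mats. null_projector A ** V ** null_projector A = 0}"

text \<open>
  The definite description is meaningful because the right-hand side does not depend on the
  decomposition. The type argument only carries the rank k.
\<close>

definition bw_S :: "'k::finite itself \<Rightarrow> real ^ 'n ^ 'n \<Rightarrow> real ^ 'n ^ 'n \<Rightarrow> real ^ 'n ^ 'n" where
  "bw_S _ A V =
     (THE S. \<exists>(Q :: real ^ 'k ^ 'n) D. Q \<in> stiefel \<and> D \<in> spd_mats \<and> diagonal_mat D \<and>
        A = Q ** D ** transpose Q \<and>
        S = Q ** sylvester D (transpose Q ** V ** Q) ** transpose Q)"

definition bw_metric ::
  "'k::finite itself \<Rightarrow> real ^ 'n ^ 'n \<Rightarrow> real ^ 'n ^ 'n \<Rightarrow> real ^ 'n ^ 'n \<Rightarrow> real" where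
  "bw_metric k A V W =
     trace (bw_S k A V ** A ** bw_S k A W) +
     trace (null_projector A ** V ** moore_penrose A ** W)"

section \<open>The quotient manifold\<close>

text \<open>
  Pairs of matrices serve both as points of the total space and as tangent vectors to it. The
  action of O(k) is the restriction of a linear action on such pairs, so \<open>act\<close> is also the
  differential of the action.
\<close>

type_synonym ('n, 'k) mat_pair = "(real ^ 'k ^ 'n) \<times> (real ^ 'k ^ 'k)"

definition act :: "('n::finite, 'k::finite) mat_pair \<Rightarrow> real ^ 'k ^ 'k \<Rightarrow> ('n, 'k) mat_pair" where
  "act p G = (case p of (Q, D) \<Rightarrow> (Q ** G, transpose G ** D ** G))"

definition total_space :: "('n::finite, 'k::finite) mat_pair set" where
  "total_space = stiefel \<times> spd_mats"

text \<open>
  The condition on V is \<open>transpose Q ** Q = mat 1\<close>, differentiated.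
\<close>

definition total_tangent :: "('n::finite, 'k::finite) mat_pair \<Rightarrow> ('n, 'k) mat_pair set" where
  "total_tangent p =
     {V. transpose (fst p) ** V + transpose V ** fst p = 0} \<times> sym_mats"

definition vertical :: "('n::finite, 'k::finite) mat_pair \<Rightarrow> ('n, 'k) mat_pair set" where
  "vertical p = (case p of (Q, D) \<Rightarrow>
     {(Q ** A, - (A ** D - D ** A)) | A. transpose A = - A})"

definition orbit_rel :: "(('n::finite, 'k::finite) mat_pair \<times> ('n, 'k) mat_pair) set" where
  "orbit_rel = {(p, q). p \<in> total_space \<and> (\<exists>G. orthogonal_matrix G \<and> q = act p G)}"

definition quot :: "('n::finite, 'k::finite) mat_pair set set" where
  "quot = total_space // orbit_rel"

definition cls :: "('n::finite, 'k::finite) mat_pair \<Rightarrow> ('n, 'k) mat_pair set" where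
  "cls p = orbit_rel `` {p}"

text \<open>
  A tangent vector of the quotient is represented by the set of all pairs (point of the total
  space, tangent vector at that point) that the differential of the projection sends to it. Two
  such pairs are identified if they differ by a vertical vector and by the action of O(k). Over a
  fixed point (Q,D) of the orbit this leaves exactly one coset of the vertical space at (Q,D).
\<close>

type_synonym ('n, 'k) tangent_vec = "(('n, 'k) mat_pair \<times> ('n, 'k) mat_pair) set"

definition tangent_rel ::
  "((('n::finite, 'k::finite) mat_pair \<times> ('n, 'k) mat_pair) \<times>
    (('n, 'k) mat_pair \<times> ('n, 'k) mat_pair)) set" where
  "tangent_rel = {((p, a), (q, b)). p \<in> total_space \<and> a \<in> total_tangent p \<and>
     (\<exists>G w. orthogonal_matrix G \<and> w \<in> vertical p \<and> q = act p G \<and> b = act (a + w) G)}"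

definition tcls ::
  "('n::finite, 'k::finite) mat_pair \<Rightarrow> ('n, 'k) mat_pair \<Rightarrow> ('n, 'k) tangent_vec" where
  "tcls p a = tangent_rel `` {(p, a)}"

definition quot_tangent ::
  "('n::finite, 'k::finite) mat_pair set \<Rightarrow> ('n, 'k) tangent_vec set" where
  "quot_tangent x = {tcls p a | p a. p \<in> x \<and> a \<in> total_tangent p}"

definition tzero :: "('n::finite, 'k::finite) mat_pair set \<Rightarrow> ('n, 'k) tangent_vec" where
  "tzero x = tangent_rel `` {(p, 0) | p. p \<in> x}"

definition tadd ::
  "('n::finite, 'k::finite) tangent_vec \<Rightarrow> ('n, 'k) tangent_vec \<Rightarrow> ('n, 'k) tangent_vec" where
  "tadd u v = tangent_rel `` {(p, a + b) | p a b. (p, a) \<in> u \<and> (p, b) \<in> v}"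

definition tscale ::
  "real \<Rightarrow> ('n::finite, 'k::finite) tangent_vec \<Rightarrow> ('n, 'k) tangent_vec" where
  "tscale c u = tangent_rel `` {(p, c *\<^sub>R a) | p a. (p, a) \<in> u}"

text \<open>
  The smooth structure of the quotient is the one for which the projection \<^const>\<open>cls\<close> is a
  surjective submersion. Hence a map out of the quotient is smooth iff its composition with the
  projection is, a covariant tensor field is smooth iff its pullback along the projection is, and
  a map into the quotient is smooth iff it has smooth local lifts.
\<close>

definition smooth_from_quot ::
  "(('n::finite, 'k::finite) mat_pair set \<Rightarrow> 'b::euclidean_space) \<Rightarrow> bool" where
  "smooth_from_quot f \<longleftrightarrow> smooth_on total_space (\<lambda>p. f (cls p))"

definition smooth_into_quot ::
  "'b::euclidean_space set \<Rightarrow> ('b \<Rightarrow> ('n::finite, 'k::finite) mat_pair set) \<Rightarrow> bool" where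
  "smooth_into_quot S f \<longleftrightarrow>
     (\<forall>s\<in>S. \<exists>U \<sigma>. open U \<and> s \<in> U \<and> smooth_on (U \<inter> S) \<sigma> \<and>
        (\<forall>t\<in>U \<inter> S. \<sigma> t \<in> total_space \<and> f t = cls (\<sigma> t)))"

definition riemannian_metric_on_quot ::
  "(('n::finite, 'k::finite) mat_pair set \<Rightarrow> ('n, 'k) tangent_vec \<Rightarrow> ('n, 'k) tangent_vec \<Rightarrow> real)
     \<Rightarrow> bool" where
  "riemannian_metric_on_quot h \<longleftrightarrow>
     (\<forall>x\<in>quot.
        (\<forall>u\<in>quot_tangent x. \<forall>v\<in>quot_tangent x. h x u v = h x v u) \<and>
        (\<forall>u\<in>quot_tangent x. \<forall>v\<in>quot_tangent x. \<forall>w\<in>quot_tangent x.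
           h x (tadd u v) w = h x u w + h x v w) \<and>
        (\<forall>c. \<forall>u\<in>quot_tangent x. \<forall>v\<in>quot_tangent x. h x (tscale c u) v = c * h x u v) \<and>
        (\<forall>u\<in>quot_tangent x. u \<noteq> tzero x \<longrightarrow> h x u u > 0)) \<and>
     smooth_on {(p, a, b). p \<in> total_space \<and> a \<in> total_tangent p \<and> b \<in> total_tangent p}
       (\<lambda>(p, a, b). h (cls p) (tcls p a) (tcls p b))"

section \<open>The diffeomorphism and the pullback metric\<close>

text \<open>
  A differentiable map \<open>\<psi>\<close> on the ambient space of the total space, constant on the orbits in the
  total space, induces a map on the quotient. By the chain rule its differential takes the class
  of a tangent vector to the image of that vector under the differential of \<open>\<psi>\<close>.
  \<^const>\<open>the_elem\<close> returns the common value on all representatives.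
\<close>

definition quot_map ::
  "(('n::finite, 'k::finite) mat_pair \<Rightarrow> 'b::euclidean_space) \<Rightarrow> ('n, 'k) mat_pair set \<Rightarrow> 'b" where
  "quot_map \<psi> x = the_elem (\<psi> ` x)"

definition quot_diff ::
  "(('n::finite, 'k::finite) mat_pair \<Rightarrow> 'b::euclidean_space) \<Rightarrow> ('n, 'k) tangent_vec \<Rightarrow> 'b" where
  "quot_diff \<psi> u = the_elem ((\<lambda>(p, a). frechet_derivative \<psi> (at p) a) ` u)"

definition phi_lift :: "('n::finite, 'k::finite) mat_pair \<Rightarrow> real ^ 'n ^ 'n" where
  "phi_lift p = (case p of (Q, D) \<Rightarrow> Q ** D ** transpose Q)"

abbreviation phi :: "('n::finite, 'k::finite) mat_pair set \<Rightarrow> real ^ 'n ^ 'n" where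
  "phi \<equiv> quot_map phi_lift"

abbreviation dphi :: "('n::finite, 'k::finite) tangent_vec \<Rightarrow> real ^ 'n ^ 'n" where
  "dphi \<equiv> quot_diff phi_lift"

definition pullback_metric ::
  "('n::finite, 'k::finite) mat_pair set \<Rightarrow> ('n, 'k) tangent_vec \<Rightarrow> ('n, 'k) tangent_vec \<Rightarrow> real" where
  "pullback_metric x u v = bw_metric TYPE('k) (phi x) (dphi u) (dphi v)"

text \<open>
  Riemannian isometries from the quotient with metric \<open>h\<close> onto a submanifold \<open>N\<close> of a Euclidean
  space with tangent spaces \<open>TN\<close> and metric \<open>g\<close>: diffeomorphisms that pull \<open>g\<close> back to \<open>h\<close>.
\<close>

definition riemannian_isometry ::
  "(('n::finite, 'k::finite) mat_pair \<Rightarrow> 'b::euclidean_space) \<Rightarrow>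
   (('n, 'k) mat_pair set \<Rightarrow> ('n, 'k) tangent_vec \<Rightarrow> ('n, 'k) tangent_vec \<Rightarrow> real) \<Rightarrow>
   'b set \<Rightarrow> ('b \<Rightarrow> 'b set) \<Rightarrow> ('b \<Rightarrow> 'b \<Rightarrow> 'b \<Rightarrow> real) \<Rightarrow> bool" where
  "riemannian_isometry \<psi> h N TN g \<longleftrightarrow>
     bij_betw (quot_map \<psi>) quot N \<and>
     smooth_from_quot (quot_map \<psi>) \<and>
     smooth_into_quot N (inv_into quot (quot_map \<psi>)) \<and>
     (\<forall>x\<in>quot.
        bij_betw (quot_diff \<psi>) (quot_tangent x) (TN (quot_map \<psi> x)) \<and>
        (\<forall>u\<in>quot_tangent x. \<forall>v\<in>quot_tangent x.
           quot_diff \<psi> (tadd u v) = quot_diff \<psi> u + quot_diff \<psi> v) \<and>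
        (\<forall>c. \<forall>u\<in>quot_tangent x. quot_diff \<psi> (tscale c u) = c *\<^sub>R quot_diff \<psi> u) \<and>
        (\<forall>u\<in>quot_tangent x. \<forall>v\<in>quot_tangent x.
           g (quot_map \<psi> x) (quot_diff \<psi> u) (quot_diff \<psi> v) = h x u v))"

end

theory Submission
  imports Defs
begin

text \<open>
  The points and tangent vectors of the quotient are fibres of maps between matrix spaces. Two factorisations
  \<open>Q D Q\<^sup>T\<close> of the same matrix differ by an orthogonal matrix (\<open>factorization_unique\<close>), so the orbits
  are the fibres of \<open>phi_lift\<close>. The kernel of its differential \<open>phi_diff\<close> at a point, restricted to
  the tangent space, is the vertical space (\<open>vertical_iff\<close>), and the differential is unchanged along
  orbits; so the tangent vectors of the quotient are the fibres of the differential
  (\<open>tangent_rel_iff\<close>). Hence \<open>phi\<close> and \<open>dphi\<close> are well defined and injective. They are surjective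
  because every positive semidefinite matrix of rank k has a factorisation, by the spectral theorem,
  and because every tangent matrix has a preimage (\<open>phi_diff_image\<close>).

  For the formula, the metric is computed from an arbitrary factorisation: the null projector is
  \<open>P = 1 - Q Q\<^sup>T\<close>, the Moore--Penrose inverse is \<open>Q E Q\<^sup>T\<close> with \<open>E\<close> the inverse of \<open>D\<close>, and
  \<open>Q S\<^sub>D(Q\<^sup>T V Q) Q\<^sup>T\<close>, where \<open>S\<^sub>D\<close> is the solution operator of the Sylvester equation, is the same for
  diagonal and non-diagonal \<open>D\<close> because \<open>S\<^sub>D\<close> is equivariant under orthogonal conjugation
  (\<open>bw_S_factorization\<close>). Inserting the images of tangent vectors \<open>(a, t)\<close> and \<open>(b, s)\<close> cancels the
  inverse of \<open>D\<close> and leaves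

  \<open>Tr (S\<^sub>D(X\<^sub>a) D S\<^sub>D(X\<^sub>b)) + Tr (P a D b\<^sup>T)\<close>, with \<open>X\<^sub>a = Q\<^sup>T a D + t + D a\<^sup>T Q\<close> and
  \<open>X\<^sub>b = Q\<^sup>T b D + s + D b\<^sup>T Q\<close>,

  which is \<open>bw_metric_phi_diff\<close>. If \<open>a\<close> and \<open>b\<close> are orthogonal to the columns of \<open>Q\<close>, then \<open>X\<^sub>a = t\<close>,
  \<open>X\<^sub>b = s\<close>, and this is the claimed formula. For equal arguments both terms are squared norms weighted
  by \<open>D\<close>; they vanish together only if the image of the vector under the differential is zero, which
  gives positive definiteness (\<open>lifted_metric_pos\<close>).

  Smoothness needs two facts about solutions of matrix equations: the solution of a linear system
  depends smoothly on the coefficients and the right-hand side (\<open>Cr_on_linear_solve\<close>), and so does the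
  positive definite square root on its argument (\<open>Cr_on_msqrt\<close>). In both cases the derivative solves
  a linear system whose data contain the solution itself, so one order of differentiability yields
  the next. The first fact makes the metric smooth. Both together give smooth local lifts of the
  inverse of \<open>phi\<close>: for \<open>A\<close> of rank k near \<open>Q\<^sub>0 D\<^sub>0 Q\<^sub>0\<^sup>T\<close>, the columns of \<open>A Q\<^sub>0\<close> form a basis of the
  range of \<open>A\<close>, and the polar decomposition orthonormalises them (\<open>local_lift\<close>).
\<close>

section \<open>Calculus of r times continuously differentiable maps\<close>

lemma Cr_on_cong:
  assumes "open U" "\<And>x. x \<in> U \<Longrightarrow> f x = g x" "Cr_on r U f"
  shows "Cr_on r U g"
  using assms(2,3)
proof (induction r arbitrary: f g)
  case 0
  then show ?case by (simp cong: continuous_on_cong)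
next
  case (Suc r)
  have der: "(g has_derivative frechet_derivative f (at x)) (at x)" if "x \<in> U" for x
  proof -
    have "(f has_derivative frechet_derivative f (at x)) (at x)"
      using Suc.prems(2) that by (simp add: frechet_derivative_works)
    then show ?thesis
      using has_derivative_transform_within_open[OF _ \<open>open U\<close> that] Suc.prems(1) by blast
  qed
  have eq: "frechet_derivative f (at x) v = frechet_derivative g (at x) v" if "x \<in> U" for x v
    using frechet_derivative_at[OF der[OF that]] by simp
  show ?case
    unfolding Cr_on.simps
  proof (intro conjI ballI allI)
    show "g differentiable (at x)" if "x \<in> U" for x
      using der[OF that] by (auto simp: differentiable_def)
    show "Cr_on r U (\<lambda>x. frechet_derivative g (at x) v)" for v
      using Suc.IH[of "\<lambda>x. frechet_derivative f (at x) v"] eq Suc.prems(2) by simp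
  qed
qed

text \<open>
  In contrast to the recursive definition, any expression for the derivative may be used here, also
  one that is valid on \<open>U\<close> only. The closure properties below rest on this rule.
\<close>

lemma Cr_on_SucI:
  assumes "open U" "\<And>x. x \<in> U \<Longrightarrow> (f has_derivative F x) (at x)"
    and "\<And>v. Cr_on r U (\<lambda>x. F x v)"
  shows "Cr_on (Suc r) U f"
  unfolding Cr_on.simps
proof (intro conjI ballI allI)
  show "f differentiable (at x)" if "x \<in> U" for x
    using assms(2)[OF that] by (auto simp: differentiable_def)
  show "Cr_on r U (\<lambda>x. frechet_derivative f (at x) v)" for v
    by (rule Cr_on_cong[OF \<open>open U\<close> _ assms(3)]) (simp add: frechet_derivative_at[OF assms(2)])
qed

lemma Cr_on_SucD_has_derivative:
  assumes "Cr_on (Suc r) U f" "x \<in> U"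
  shows "(f has_derivative frechet_derivative f (at x)) (at x)"
  using assms by (simp add: frechet_derivative_works)

lemma Cr_on_SucD: "Cr_on (Suc r) U f \<Longrightarrow> Cr_on r U f"
proof (induction r arbitrary: f)
  case 0
  then have "f differentiable_on U"
    by (simp add: differentiable_at_imp_differentiable_on)
  then show ?case by (simp add: differentiable_imp_continuous_on)
qed auto

lemma Cr_on_const:
  assumes "open U" shows "Cr_on r U (\<lambda>_. c)"
proof (induction r arbitrary: c)
  case (Suc r)
  show ?case by (rule Cr_on_SucI[OF assms has_derivative_const Suc])
qed simp

lemma Cr_on_linear:
  assumes "open U" "bounded_linear L" shows "Cr_on r U L"
proof (cases r)
  case 0
  then show ?thesis using assms(2) by (simp add: linear_continuous_on)
next
  case (Suc s)
  show ?thesis unfolding Suc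
    by (rule Cr_on_SucI[OF assms(1) bounded_linear_imp_has_derivative[OF assms(2)]])
      (rule Cr_on_const[OF assms(1)])
qed

lemma Cr_on_linear_compose:
  assumes "open U" "bounded_linear L" "Cr_on r U f"
  shows "Cr_on r U (\<lambda>x. L (f x))"
  using assms(3)
proof (induction r arbitrary: f)
  case 0
  then show ?case
    using assms(2) by (auto intro: continuous_intros bounded_linear.continuous_on)
next
  case (Suc r)
  show ?case
    by (rule Cr_on_SucI[OF assms(1) bounded_linear.has_derivative[OF assms(2)
            Cr_on_SucD_has_derivative[OF Suc.prems]]])
      (use Suc in auto)
qed

lemma Cr_on_add:
  assumes "open U" "Cr_on r U f" "Cr_on r U g"
  shows "Cr_on r U (\<lambda>x. f x + g x)"
  using assms(2,3)
proof (induction r arbitrary: f g)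
  case (Suc r)
  show ?case
    by (rule Cr_on_SucI[OF assms(1) has_derivative_add[OF
            Cr_on_SucD_has_derivative[OF Suc.prems(1)] Cr_on_SucD_has_derivative[OF Suc.prems(2)]]])
      (use Suc in auto)
qed (simp add: continuous_on_add)

lemma Cr_on_diff:
  assumes "open U" "Cr_on r U f" "Cr_on r U g"
  shows "Cr_on r U (\<lambda>x. f x - g x)"
  using Cr_on_add[OF assms(1,2) Cr_on_linear_compose[OF assms(1) bounded_linear_minus[OF bounded_linear_ident] assms(3)]]
  by simp

lemma Cr_on_Pair:
  fixes f :: "'a::real_normed_vector \<Rightarrow> 'b::real_normed_vector"
    and g :: "'a \<Rightarrow> 'c::real_normed_vector"
  assumes "open U" "Cr_on r U f" "Cr_on r U g"
  shows "Cr_on r U (\<lambda>x. (f x, g x))"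
proof -
  have "Cr_on r U (\<lambda>x. (f x, 0::'c) + (0::'b, g x))"
    by (intro Cr_on_add[OF assms(1)] Cr_on_linear_compose[OF assms(1) _ assms(2)]
        Cr_on_linear_compose[OF assms(1) _ assms(3)])
      (auto intro: bounded_linear_Pair bounded_linear_ident bounded_linear_zero)
  then show ?thesis by simp
qed

text \<open>
  By the product rule the derivative is a sum of two products of the same kind, so the induction has
  to run over all pairs of maps at once.
\<close>

lemma Cr_on_bilinear:
  assumes "open U" "bounded_bilinear mul" "Cr_on r U f" "Cr_on r U g"
  shows "Cr_on r U (\<lambda>x. mul (f x) (g x))"
  using assms(3,4)
proof (induction r arbitrary: f g)
  case 0
  then show ?case
    using bounded_bilinear.continuous_on[OF assms(2)] by auto
next
  case (Suc r)
  show ?case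
  proof (rule Cr_on_SucI[OF assms(1) bounded_bilinear.FDERIV[OF assms(2)
            Cr_on_SucD_has_derivative[OF Suc.prems(1)] Cr_on_SucD_has_derivative[OF Suc.prems(2)]]])
    show "Cr_on r U (\<lambda>x. mul (f x) (frechet_derivative g (at x) v)
             + mul (frechet_derivative f (at x) v) (g x))" for v
      by (rule Cr_on_add[OF assms(1) Suc.IH Suc.IH]) (use Suc.prems in \<open>auto intro: Cr_on_SucD\<close>)
  qed
qed

text \<open>
  An injective linear map between finite-dimensional spaces is bounded below, and the bound survives
  a small perturbation of the coefficient. This gives the locally uniform bound on the inverse.
\<close>

lemma bounded_bilinear_bounded_below_near:
  fixes mul :: "'a::euclidean_space \<Rightarrow> 'b::euclidean_space \<Rightarrow> 'b"
  assumes "bounded_bilinear mul" "inj (mul a0)"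
  obtains c d where "c > 0" "d > 0" "\<And>a z. dist a a0 < d \<Longrightarrow> c * norm z \<le> norm (mul a z)"
proof -
  interpret bounded_bilinear mul by fact
  have lin: "linear (mul a)" for a by (simp add: bounded_linear_right bounded_linear.linear)
  obtain B where B: "B > 0" "\<And>z. B * norm z \<le> norm (mul a0 z)"
    using linear_inj_bounded_below_pos[OF lin assms(2)] by blast
  obtain K where K: "K > 0" "\<And>a z. norm (mul a z) \<le> norm a * norm z * K"
    using pos_bounded by blast
  show thesis
  proof (rule that[of "B/2" "B/(2*K)"])
    fix a z assume a: "dist a a0 < B/(2*K)"
    have "norm (mul (a - a0) z) \<le> norm (a - a0) * norm z * K" by (rule K)
    also have "\<dots> = norm (a - a0) * (norm z * K)" by simp
    also have "\<dots> \<le> B/(2*K) * (norm z * K)"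
      using a K(1) by (intro mult_right_mono) (auto simp: dist_norm)
    also have "\<dots> = B/2 * norm z" using K(1) by simp
    finally have "norm (mul (a - a0) z) \<le> B/2 * norm z" .
    moreover have "norm (mul a0 z) \<le> norm (mul a z) + norm (mul (a - a0) z)"
      by (metis add.commute diff_left norm_triangle_sub norm_minus_commute)
    ultimately show "B/2 * norm z \<le> norm (mul a z)" using B(2)[of z] by simp
  qed (use B K in auto)
qed

lemma inj_linear_solve:
  fixes f :: "'b::euclidean_space \<Rightarrow> 'b"
  assumes "linear f" "inj f"
  shows "f (inv f y) = y"
  using linear_injective_imp_surjective[OF assms] by (simp add: surj_f_inv_f)

text \<open>
  Differentiating \<open>mul a z = g\<close> gives \<open>mul a dz = dg - mul da z\<close>. The candidate \<open>l\<close> for \<open>dz\<close> that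
  solves this system at the base point leaves the error \<open>e\<close> with \<open>mul a e = - mul da l\<close>, which is of
  second order because \<open>mul a\<close> is uniformly bounded below near the base point.
\<close>

lemma has_derivative_linear_solve:
  fixes mul :: "'a::euclidean_space \<Rightarrow> 'b::euclidean_space \<Rightarrow> 'b"
  assumes bil: "bounded_bilinear mul" and inj: "inj (mul a0)"
  shows "((\<lambda>(a, g). inv (mul a) g) has_derivative
           (\<lambda>(da, dg). inv (mul a0) (dg - mul da (inv (mul a0) g0)))) (at (a0, g0))"
proof -
  interpret bounded_bilinear mul by fact
  have lin: "linear (mul a)" for a by (simp add: bounded_linear_right bounded_linear.linear)
  obtain c d where cd: "c > 0" "d > 0" "\<And>a z. dist a a0 < d \<Longrightarrow> c * norm z \<le> norm (mul a z)"
    using bounded_bilinear_bounded_below_near[OF bil inj] by blast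
  obtain K where K: "K > 0" "\<And>a z. norm (mul a z) \<le> norm a * norm z * K"
    using pos_bounded by blast
  have inj': "inj (mul a)" if "dist a a0 < d" for a
    unfolding linear_injective_0[OF lin]
  proof (intro allI impI)
    fix z assume "mul a z = 0"
    then have "c * norm z \<le> 0" using cd(3)[OF that, of z] by simp
    then show "z = 0" using cd(1) by (simp add: mult_le_0_iff)
  qed
  have solve: "mul a (inv (mul a) g) = g" if "dist a a0 < d" for a g
    by (rule inj_linear_solve[OF lin inj'[OF that]])
  have bl_inv: "bounded_linear (inv (mul a0))"
    using inj_linear_imp_inv_bounded_linear[OF bounded_linear_right inj] .
  define z0 where "z0 = inv (mul a0) g0"
  define L where "L = (\<lambda>(da, dg). inv (mul a0) (dg - mul da z0))"
  have bl_L: "bounded_linear L"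
  proof -
    have "bounded_linear (\<lambda>p. inv (mul a0) (snd p - mul (fst p) z0))"
      by (intro bounded_linear_compose[OF bl_inv] bounded_linear_sub bounded_linear_snd
          bounded_linear_compose[OF bounded_linear_left] bounded_linear_fst)
    then show ?thesis by (simp add: L_def case_prod_unfold)
  qed
  obtain KL where KL: "KL > 0" "\<And>p. norm (L p) \<le> norm p * KL"
    using bounded_linear.pos_bounded[OF bl_L] by blast
  have "((\<lambda>(a, g). inv (mul a) g) has_derivative L) (at (a0, g0))"
  proof (rule has_derivativeI_sandwich[OF \<open>d > 0\<close> bl_L])
    fix p assume p: "p \<noteq> (a0, g0)" "dist p (a0, g0) < d"
    obtain a g where ag: "p = (a, g)" by force
    have near: "dist a a0 < d" using p(2) dist_fst_le[of p "(a0, g0)"] ag by simp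
    let ?D = "(a - a0, g - g0)"
    define l where "l = L ?D"
    define N where "N = norm ?D"
    have l: "mul a0 l = g - g0 - mul (a - a0) z0"
      unfolding l_def L_def using solve[of a0] \<open>d > 0\<close> by simp
    have z0: "mul a0 z0 = g0" unfolding z0_def using solve[of a0] \<open>d > 0\<close> by simp
    let ?e = "inv (mul a) g - z0 - l"
    have "mul a l = g - g0 - mul (a - a0) z0 + mul (a - a0) l" "mul a z0 = g0 + mul (a - a0) z0"
      using l z0 by (simp_all add: diff_left)
    then have "mul a ?e = - mul (a - a0) l"
      by (simp add: diff_right solve[OF near])
    then have "c * norm ?e \<le> norm (a - a0) * norm l * K"
      using cd(3)[OF near, of ?e] K(2)[of "a - a0" l] by simp
    also have "\<dots> \<le> N * (N * KL) * K"
      using KL(2)[of ?D] K(1) norm_fst_le[of "a - a0" "g - g0"]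
      by (intro mult_right_mono mult_mono) (auto simp: l_def N_def)
    finally have le: "c * norm ?e \<le> N * (N * KL) * K" .
    have "N > 0" using p(1) ag by (auto simp: N_def zero_prod_def)
    then have "norm ?e / N \<le> N * KL * K / c"
      using le cd(1) by (simp add: pos_divide_le_eq pos_le_divide_eq mult.commute mult.left_commute)
    then show "norm ((case p of (a, g) \<Rightarrow> inv (mul a) g) -
           (case (a0, g0) of (a, g) \<Rightarrow> inv (mul a) g) - L (p - (a0, g0))) / norm (p - (a0, g0))
        \<le> norm (p - (a0, g0)) * KL * K / c"
      by (simp only: ag case_prod_conv diff_Pair N_def l_def z0_def)
  next
    have "((\<lambda>p. norm (p - (a0, g0)) * KL * K / c) \<longlongrightarrow> norm ((a0, g0) - (a0, g0)) * KL * K / c) (at (a0, g0))"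
      using cd(1) by (intro tendsto_intros) auto
    then show "((\<lambda>p. norm (p - (a0, g0)) * KL * K / c) \<longlongrightarrow> 0) (at (a0, g0))" by simp
  qed
  then show ?thesis unfolding L_def z0_def .
qed

text \<open>
  The derivative of the solution of a linear system solves a linear system with the same coefficients,
  and the solution itself enters its right-hand side. Hence, for all right-hand sides at once, solutions
  of class \<open>r\<close> have derivatives of class \<open>r\<close>.
\<close>

lemma Cr_on_linear_solve:
  fixes mul :: "'a::euclidean_space \<Rightarrow> 'b::euclidean_space \<Rightarrow> 'b"
  assumes "open U" and bil: "bounded_bilinear mul" and inj: "\<And>x. x \<in> U \<Longrightarrow> inj (mul (f x))"
    and "Cr_on r U f" "Cr_on r U g"
  shows "Cr_on r U (\<lambda>x. inv (mul (f x)) (g x))"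
  using assms(4,5) inj
proof (induction r arbitrary: f g)
  case 0
  show ?case
    unfolding Cr_on.simps continuous_on_eq_continuous_at[OF \<open>open U\<close>]
  proof
    fix x assume x: "x \<in> U"
    have "isCont (\<lambda>(a, g). inv (mul a) g) (f x, g x)"
      using has_derivative_continuous[OF has_derivative_linear_solve[OF bil]] 0(3)[OF x] by blast
    moreover have "isCont (\<lambda>x. (f x, g x)) x"
      using 0(1,2) x by (simp add: continuous_on_eq_continuous_at[OF \<open>open U\<close>] isCont_Pair)
    ultimately show "isCont (\<lambda>x. inv (mul (f x)) (g x)) x"
      using isCont_o2[of x "\<lambda>x. (f x, g x)" "\<lambda>(a, g). inv (mul a) g"] by simp
  qed
next
  case (Suc r)
  let ?y = "\<lambda>x. inv (mul (f x)) (g x)"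
  let ?f' = "\<lambda>x. frechet_derivative f (at x)" and ?g' = "\<lambda>x. frechet_derivative g (at x)"
  show ?case
  proof (rule Cr_on_SucI[OF \<open>open U\<close>])
    fix x assume x: "x \<in> U"
    have "((\<lambda>x. (f x, g x)) has_derivative (\<lambda>v. (?f' x v, ?g' x v))) (at x)"
      by (rule has_derivative_Pair[OF Cr_on_SucD_has_derivative[OF Suc.prems(1) x]
            Cr_on_SucD_has_derivative[OF Suc.prems(2) x]])
    from has_derivative_compose[OF this has_derivative_linear_solve[OF bil Suc.prems(3)[OF x], of "g x"]]
    show "(?y has_derivative (\<lambda>v. inv (mul (f x)) (?g' x v - mul (?f' x v) (?y x)))) (at x)"
      by (simp only: case_prod_conv)
  next
    fix v
    have y: "Cr_on r U ?y"
      by (rule Suc.IH[OF Cr_on_SucD[OF Suc.prems(1)] Cr_on_SucD[OF Suc.prems(2)] Suc.prems(3)])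
    have "Cr_on r U (\<lambda>x. ?f' x v)" "Cr_on r U (\<lambda>x. ?g' x v)"
      using Suc.prems(1,2) by auto
    then have "Cr_on r U (\<lambda>x. ?g' x v - mul (?f' x v) (?y x))"
      by (intro Cr_on_diff[OF \<open>open U\<close>] Cr_on_bilinear[OF \<open>open U\<close> bil] y)
    then show "Cr_on r U (\<lambda>x. inv (mul (f x)) (?g' x v - mul (?f' x v) (?y x)))"
      by (rule Suc.IH[OF Cr_on_SucD[OF Suc.prems(1)] _ Suc.prems(3)])
  qed
qed

section \<open>Matrix algebra\<close>

lemma bounded_bilinear_matrix_mult:
  "bounded_bilinear ((**) :: real^'m^'n \<Rightarrow> real^'k^'m \<Rightarrow> real^'k^'n)"
proof -
  have "bilinear ((**) :: real^'m^'n \<Rightarrow> real^'k^'m \<Rightarrow> real^'k^'n)"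
    unfolding bilinear_def linear_iff
    by (simp add: vec_eq_iff matrix_matrix_mult_def sum.distrib sum_distrib_left algebra_simps)
  then show ?thesis by (simp add: bilinear_conv_bounded_bilinear)
qed

interpretation matrix_mult: bounded_bilinear
  "(**) :: real^'m^'n \<Rightarrow> real^'k^'m \<Rightarrow> real^'k^'n"
  by (rule bounded_bilinear_matrix_mult)

lemma bounded_linear_transpose: "bounded_linear (transpose :: real^'m^'n \<Rightarrow> real^'n^'m)"
  by (simp add: linear_conv_bounded_linear[symmetric] linear_iff transpose_def vec_eq_iff)


lemma bounded_linear_trace: "bounded_linear (trace :: real^'n^'n \<Rightarrow> real)"
  by (simp add: linear_conv_bounded_linear[symmetric] linear_iff trace_def sum.distrib sum_distrib_left)

text \<open>
  Rewriting to sums of left-associated products with the transposes pushed inwards; identities between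
  matrix expressions are decided by comparing these normal forms after the cancellation rules.
\<close>

lemmas matrix_simps = matrix_mult.add_left matrix_mult.add_right matrix_mult.diff_left
  matrix_mult.diff_right matrix_mult.minus_left matrix_mult.minus_right matrix_mult.zero_left
  matrix_mult.zero_right matrix_mult.scaleR_left matrix_mult.scaleR_right
  bounded_linear_transpose[THEN bounded_linear.linear, THEN linear_add]
  bounded_linear_transpose[THEN bounded_linear.linear, THEN linear_diff]
  bounded_linear_transpose[THEN bounded_linear.linear, THEN linear_neg]
  bounded_linear_transpose[THEN bounded_linear.linear, THEN linear_0]
  bounded_linear_transpose[THEN bounded_linear.linear, THEN linear_scale]
 
  matrix_transpose_mul matrix_mul_assoc

lemma trace_transpose: "trace (transpose A) = trace A"
  by (simp add: trace_def transpose_def)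

lemma inner_transpose: "transpose A \<bullet> transpose B = A \<bullet> (B :: real^'m^'n)"
  unfolding inner_vec_def transpose_def
  by (simp, rule sum.swap)

lemma inner_matrix_trace: "A \<bullet> B = trace (transpose A ** (B :: real^'m^'n))"
proof -
  have "trace (transpose A ** B) = transpose A \<bullet> transpose B"
    by (simp add: trace_def matrix_matrix_mult_def inner_vec_def transpose_def)
  then show ?thesis by (simp add: inner_transpose)
qed

section \<open>Positive definite matrices\<close>

text \<open>
  The Frobenius inner product splits over the rows of \<open>C\<close>, so bounds for the quadratic form of \<open>D\<close>
  become bounds for right multiplication by \<open>D\<close>.
\<close>

lemma inner_matrix_mult_right: "C \<bullet> (C ** (D :: real^'k^'k)) = (\<Sum>i\<in>UNIV. C $ i \<bullet> (D *v C $ i))"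
proof -
  have "(C ** D) $ i = C $ i v* D" for i
    by (simp add: vec_eq_iff matrix_matrix_mult_def vector_matrix_mult_def mult.commute)
  then have "C $ i \<bullet> (C ** D) $ i = C $ i \<bullet> (D *v C $ i)" for i
    by (metis dot_lmul_matrix inner_commute)
  then show ?thesis by (subst inner_vec_def) simp
qed

text \<open>
  The form attains its minimum on the compact unit sphere, and this minimum is the constant.
\<close>

lemma pos_form_coercive:
  fixes D :: "real^'k^'k"
  assumes "\<And>x. x \<noteq> 0 \<Longrightarrow> x \<bullet> (D *v x) > 0"
  obtains c where "c > 0" "\<And>x. c * (norm x)\<^sup>2 \<le> x \<bullet> (D *v x)"
proof -
  let ?f = "\<lambda>x. x \<bullet> (D *v x)"
  have cont: "continuous_on (sphere 0 1) ?f"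
    by (intro continuous_intros linear_continuous_on) (simp add: matrix_vector_mul_bounded_linear)
  have ne: "(sphere 0 1 :: (real^'k) set) \<noteq> {}" by simp
  obtain u where u: "u \<in> sphere 0 1" "\<And>y. y \<in> sphere 0 1 \<Longrightarrow> ?f u \<le> ?f y"
    using continuous_attains_inf[OF compact_sphere ne cont] by blast
  show thesis
  proof (rule that)
    show "?f u > 0" using u(1) assms[of u] by (metis norm_zero mem_sphere_0 zero_neq_one)
    fix x :: "real^'k"
    show "?f u * (norm x)\<^sup>2 \<le> ?f x"
    proof (cases "x = 0")
      case False
      have "?f u \<le> ?f (x /\<^sub>R norm x)" by (rule u(2)) (use False in simp)
      also have "\<dots> = ?f x / (norm x)\<^sup>2"
        by (simp add: matrix_vector_mult_scaleR power2_eq_square divide_inverse)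
      finally show ?thesis using False by (simp add: pos_le_divide_eq)
    qed simp
  qed
qed

lemma spd_matsD:
  assumes "D \<in> spd_mats"
  shows "transpose D = D" "x \<noteq> 0 \<Longrightarrow> x \<bullet> (D *v x) > 0"
  using assms by (auto simp: spd_mats_def sym_mats_def)

text \<open>
  Positive definiteness without symmetry: smoothness is tested on open sets of matrices, and the
  symmetric positive definite matrices are in general not open in the space of all matrices.
\<close>

lemma open_pos_form: "open {D :: real^'k^'k. \<forall>x. x \<noteq> 0 \<longrightarrow> x \<bullet> (D *v x) > 0}"
  unfolding open_dist
proof (intro ballI)
  fix D :: "real^'k^'k"
  assume "D \<in> {D. \<forall>x. x \<noteq> 0 \<longrightarrow> x \<bullet> (D *v x) > 0}"
  then obtain c where c: "c > 0" "\<And>x. c * (norm x)\<^sup>2 \<le> x \<bullet> (D *v x)"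
    using pos_form_coercive[of D] by blast
  have "bounded_bilinear ((*v) :: real^'k^'k \<Rightarrow> _)"
    by (simp add: bilinear_conv_bounded_bilinear[symmetric] bilinear_def linear_iff
        matrix_vector_mult_add_rdistrib matrix_vector_right_distrib
        scaleR_matrix_vector_assoc matrix_vector_mult_scaleR)
  then obtain K where K: "K > 0" "\<And>(E :: real^'k^'k) x. norm (E *v x) \<le> norm E * norm x * K"
    using bounded_bilinear.pos_bounded by blast
  show "\<exists>e>0. \<forall>E. dist E D < e \<longrightarrow> E \<in> {D. \<forall>x. x \<noteq> 0 \<longrightarrow> x \<bullet> (D *v x) > 0}"
  proof (intro exI[of _ "c / K"] conjI allI impI CollectI)
    fix E x assume E: "dist E D < c / K" and x: "(x :: real^'k) \<noteq> 0"
    have "\<bar>x \<bullet> ((E - D) *v x)\<bar> \<le> norm x * (norm (E - D) * norm x * K)"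
      using Cauchy_Schwarz_ineq2[of x "(E - D) *v x"] K(2)[of "E - D" x]
      by (meson mult_left_mono norm_ge_zero order_trans)
    also have "\<dots> = (norm (E - D) * K) * (norm x)\<^sup>2" by (simp add: power2_eq_square)
    also have "\<dots> < c * (norm x)\<^sup>2"
      using E K(1) x by (intro mult_strict_right_mono) (auto simp: dist_norm pos_less_divide_eq)
    finally show "x \<bullet> (E *v x) > 0"
      using c(2)[of x] by (simp add: matrix_vector_mult_diff_rdistrib inner_diff_right)
  qed (use c K in auto)
qed

lemma inner_mult_right_nonneg:
  assumes "\<And>x. x \<bullet> (D *v x) \<ge> 0"
  shows "(C :: real^'k^'n) \<bullet> (C ** D) \<ge> 0"
  unfolding inner_matrix_mult_right by (intro sum_nonneg assms)

lemma spd_coercive: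
  assumes "D \<in> spd_mats"
  obtains c where "c > 0" "\<And>C :: real^'k^'n. c * (norm C)\<^sup>2 \<le> C \<bullet> (C ** D)"
proof -
  obtain c where c: "c > 0" "\<And>x. c * (norm x)\<^sup>2 \<le> x \<bullet> (D *v x)"
    using pos_form_coercive[of D] spd_matsD[OF assms] by blast
  show thesis
  proof (rule that[OF c(1)])
    fix C :: "real^'k^'n"
    have "c * (norm C)\<^sup>2 = (\<Sum>i\<in>UNIV. c * (norm (C $ i))\<^sup>2)"
      by (simp only: power2_norm_eq_inner inner_vec_def[of C C] sum_distrib_left)
    also have "\<dots> \<le> C \<bullet> (C ** D)" unfolding inner_matrix_mult_right by (intro sum_mono c)
    finally show "c * (norm C)\<^sup>2 \<le> C \<bullet> (C ** D)" .
  qed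
qed

lemma inner_mult_left: 
  assumes "transpose D = D" shows "C \<bullet> (D ** C) = transpose C \<bullet> (transpose C ** (D :: real^'k^'k))"
  using assms by (metis inner_transpose matrix_transpose_mul)

lemma norm_transpose: "norm (transpose C) = norm (C :: real^'m^'n)"
  by (simp add: norm_eq_sqrt_inner inner_transpose)

lemma spd_invertible:
  assumes "D \<in> spd_mats"
  obtains E where "E ** D = mat 1" "D ** E = mat 1" "transpose E = (E :: real^'k^'k)"
proof -
  have "D *v x = 0 \<Longrightarrow> x = 0" for x using spd_matsD(2)[OF assms, of x] by force
  then obtain E where E: "E ** D = mat 1"
    by (metis matrix_left_invertible_ker)
  then have E': "D ** E = mat 1" by (simp add: matrix_left_right_inverse)
  have "transpose E ** D = mat 1"
    by (metis E' matrix_transpose_mul spd_matsD(1)[OF assms] transpose_mat)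
  then have "transpose E = E"
    by (metis E' matrix_mul_assoc matrix_mul_lid matrix_mul_rid)
  with E E' show thesis by (rule that)
qed

section \<open>The Sylvester equation\<close>

text \<open>
  The left-hand side of the Sylvester equation, as a bilinear map to which the results on linear
  systems apply.
\<close>

definition anticommutator :: "real^'k^'k \<Rightarrow> real^'k^'k \<Rightarrow> real^'k^'k" where
  "anticommutator D C = D ** C + C ** D"

lemma bounded_bilinear_anticommutator: "bounded_bilinear anticommutator"
proof -
  have "bilinear anticommutator"
    by (simp add: bilinear_def linear_iff anticommutator_def matrix_simps scaleR_add_right)
  then show ?thesis by (simp add: bilinear_conv_bounded_bilinear)
qed

text \<open>
  Pairing \<open>D ** C + C ** D = 0\<close> with \<open>C\<close> gives a sum of two terms, each at least a positive multiple
  of the squared norm of \<open>C\<close>.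
\<close>

lemma inj_anticommutator:
  assumes D: "(D :: real^'k^'k) \<in> spd_mats" shows "inj (anticommutator D)"
proof -
  obtain c where c: "c > 0" "\<And>C :: real^'k^'k. c * (norm C)\<^sup>2 \<le> C \<bullet> (C ** D)"
    using spd_coercive[OF D] by blast
  interpret bounded_bilinear anticommutator by (rule bounded_bilinear_anticommutator)
  have "C = 0" if "anticommutator D C = 0" for C
  proof -
    have "0 = C \<bullet> (D ** C) + C \<bullet> (C ** D)"
      using that by (metis anticommutator_def inner_add_right inner_zero_right)
    also have "\<dots> = transpose C \<bullet> (transpose C ** D) + C \<bullet> (C ** D)"
      by (simp add: inner_mult_left spd_matsD[OF D])
    also have "\<dots> \<ge> c * (norm C)\<^sup>2 + c * (norm C)\<^sup>2"
      using c(2)[of C] c(2)[of "transpose C"] by (simp add: norm_transpose)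
    finally show ?thesis using c(1) by (simp add: mult_le_0_iff)
  qed
  moreover have "linear (anticommutator D)"
    by (simp add: bounded_linear_right bounded_linear.linear)
  ultimately show ?thesis by (simp add: linear_injective_0)
qed

lemma
  assumes "D \<in> spd_mats"
  shows sylvester_eq_inv: "sylvester D B = inv (anticommutator D) B"
    and sylvester_solves: "D ** sylvester D B + sylvester D B ** D = B"
proof -
  have inj: "inj (anticommutator D)" by (rule inj_anticommutator[OF assms])
  have lin: "linear (anticommutator D)"
    using bounded_bilinear.bounded_linear_right[OF bounded_bilinear_anticommutator]
    by (rule bounded_linear.linear)
  have *: "anticommutator D (inv (anticommutator D) B) = B"
    by (rule inj_linear_solve[OF lin inj])
  show eq: "sylvester D B = inv (anticommutator D) B"
    unfolding sylvester_def
  proof (rule the_equality)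
    show "D ** inv (anticommutator D) B + inv (anticommutator D) B ** D = B"
      using * by (simp add: anticommutator_def)
    fix C assume "D ** C + C ** D = B"
    then have "anticommutator D C = B" by (simp add: anticommutator_def)
    then show "C = inv (anticommutator D) B" using inv_f_f[OF inj] by metis
  qed
  show "D ** sylvester D B + sylvester D B ** D = B"
    using * by (simp add: eq anticommutator_def[symmetric])
qed

lemma sylvester_unique:
  assumes "D \<in> spd_mats" "D ** C + C ** D = B" shows "sylvester D B = C"
  using inv_f_f[OF inj_anticommutator[OF assms(1)], of C] assms
  by (simp add: sylvester_eq_inv anticommutator_def)

lemma linear_sylvester:
  assumes "D \<in> spd_mats" shows "linear (sylvester D)"
proof (rule linearI)
  note s = sylvester_solves[OF assms]
  show "sylvester D (a + b) = sylvester D a + sylvester D b" for a b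
    using s[of a] s[of b] by (intro sylvester_unique[OF assms]) (simp add: matrix_simps algebra_simps)
  show "sylvester D (c *\<^sub>R a) = c *\<^sub>R sylvester D a" for c a
    using s[of a] by (intro sylvester_unique[OF assms])
      (metis matrix_mult.scaleR_left matrix_mult.scaleR_right scaleR_add_right)
qed

lemma transpose_sylvester:
  assumes "D \<in> spd_mats" shows "transpose (sylvester D B) = sylvester D (transpose B)"
proof (rule sylvester_unique[OF assms, symmetric])
  have "transpose (D ** sylvester D B + sylvester D B ** D) = transpose B"
    by (simp add: sylvester_solves[OF assms])
  then show "D ** transpose (sylvester D B) + transpose (sylvester D B) ** D = transpose B"
    by (simp add: matrix_simps spd_matsD[OF assms] add.commute)
qed

lemma orthogonal_matrixD:
  assumes "orthogonal_matrix G" shows "transpose G ** G = mat 1" "G ** transpose G = mat 1"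
  using assms by (auto simp: orthogonal_matrix_def)

lemma inverse_cancel: "D ** E = mat 1 \<Longrightarrow> X ** D ** E = X"
  by (metis matrix_mul_assoc matrix_mul_rid)

lemma orthogonal_cancel:
  assumes "orthogonal_matrix G"
  shows "X ** G ** transpose G = X" "X ** transpose G ** G = X"
  using orthogonal_matrixD[OF assms] by (simp_all add: inverse_cancel)

lemma inner_conjugate: "x \<bullet> ((transpose G ** D ** G) *v x) = (G *v x) \<bullet> (D *v (G *v (x :: real^'k)))"
  by (metis dot_lmul_matrix matrix_vector_mul_assoc transpose_transpose vector_transpose_matrix)

lemma spd_conjugate:
  assumes "D \<in> spd_mats" "orthogonal_matrix G" shows "transpose G ** D ** G \<in> spd_mats"
proof -
  have "x \<bullet> ((transpose G ** D ** G) *v x) > 0" if "x \<noteq> 0" for x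
  proof -
    have "G *v x \<noteq> 0"
      using that orthogonal_matrixD(1)[OF assms(2)]
      by (metis matrix_vector_mul_assoc matrix_vector_mul_lid matrix_vector_mult_0_right)
    then have "0 < (G *v x) \<bullet> (D *v (G *v x))" by (rule spd_matsD(2)[OF assms(1)])
    then show ?thesis by (simp only: inner_conjugate)
  qed
  then show ?thesis
    by (simp add: spd_mats_def sym_mats_def matrix_simps spd_matsD[OF assms(1)])
qed

text \<open>
  The conjugate of the solution solves the conjugate equation. This is why the metric does not depend
  on the factorisation and why its formula is invariant under the orthogonal group.
\<close>

lemma sylvester_conjugate:
  assumes D: "D \<in> spd_mats" and G: "orthogonal_matrix G"
  shows "sylvester (transpose G ** D ** G) (transpose G ** B ** G)
    = transpose G ** sylvester D B ** G"
proof (rule sylvester_unique[OF spd_conjugate[OF assms]])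
  have "transpose G ** (D ** sylvester D B + sylvester D B ** D) ** G = transpose G ** B ** G"
    by (simp add: sylvester_solves[OF D])
  then show "transpose G ** D ** G ** (transpose G ** sylvester D B ** G) +
      transpose G ** sylvester D B ** G ** (transpose G ** D ** G) = transpose G ** B ** G"
    by (simp add: matrix_simps orthogonal_cancel[OF G])
qed

lemma Cr_on_sylvester:
  assumes "open U" "\<And>x. x \<in> U \<Longrightarrow> f x \<in> spd_mats" "Cr_on r U f" "Cr_on r U g"
  shows "Cr_on r U (\<lambda>x. sylvester (f x) (g x))"
  by (rule Cr_on_cong[OF assms(1) _ Cr_on_linear_solve[OF assms(1) bounded_bilinear_anticommutator
        inj_anticommutator[OF assms(2)] assms(3,4)]])
    (simp_all add: sylvester_eq_inv assms(2))

section \<open>The spectral theorem for symmetric matrices\<close>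

lemma sym_inner: "transpose A = A \<Longrightarrow> x \<bullet> (A *v y) = (A *v x) \<bullet> (y :: real^'n)"
  by (metis dot_lmul_matrix vector_transpose_matrix)

text \<open>
  Let \<open>l\<close> be the maximum of the quadratic form on the unit sphere of \<open>S\<close>, attained at \<open>x\<close>. The form
  minus \<open>l\<close> times the squared norm is nowhere positive on \<open>S\<close> and vanishes at \<open>x\<close>, so its first-order
  change along \<open>w = A x - l x\<close> is zero; this change is \<open>2 (w \<bullet> w)\<close>.
\<close>

lemma symmetric_has_eigenvector:
  fixes A :: "real^'n^'n"
  assumes sym: "transpose A = A" and S: "subspace S" "S \<noteq> {0}" and inv: "\<And>x. x \<in> S \<Longrightarrow> A *v x \<in> S"
  obtains x where "x \<in> S" "norm x = 1" "A *v x = (x \<bullet> (A *v x)) *\<^sub>R x"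
proof -
  let ?f = "\<lambda>x. x \<bullet> (A *v x)"
  obtain y where y: "y \<in> S" "y \<noteq> 0" using S subspace_0 by blast
  then have "y /\<^sub>R norm y \<in> S \<inter> sphere 0 1" by (simp add: subspace_scale[OF S(1)])
  then have ne: "S \<inter> sphere 0 1 \<noteq> {}" by blast
  have comp: "compact (S \<inter> sphere 0 1)" by (simp add: closed_Int_compact closed_subspace[OF S(1)])
  have cont: "continuous_on (S \<inter> sphere 0 1) ?f"
    by (intro continuous_intros linear_continuous_on) (simp add: matrix_vector_mul_bounded_linear)
  obtain x where x: "x \<in> S" "norm x = 1" and max: "\<And>y. y \<in> S \<inter> sphere 0 1 \<Longrightarrow> ?f y \<le> ?f x"
    using continuous_attains_sup[OF comp ne cont] by auto
  define l where "l = ?f x"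
  have le: "?f z \<le> l * (z \<bullet> z)" if "z \<in> S" for z
  proof (cases "z = 0")
    case False
    have "?f (z /\<^sub>R norm z) \<le> l"
      unfolding l_def by (rule max) (use that False in \<open>simp add: subspace_scale[OF S(1)]\<close>)
    moreover have "?f (z /\<^sub>R norm z) = ?f z / (z \<bullet> z)"
      by (simp add: matrix_vector_mult_scaleR power2_norm_eq_inner[symmetric] power2_eq_square divide_inverse)
    ultimately show ?thesis using False by (simp add: pos_divide_le_eq)
  qed simp
  \<comment> \<open>The defect of the eigenvalue equation, which is orthogonal to \<open>x\<close>.\<close>
  define w where "w = A *v x - l *\<^sub>R x"
  have wS: "w \<in> S" unfolding w_def by (intro subspace_diff subspace_scale S inv x)
  have xx: "x \<bullet> x = 1" using x(2) by (simp add: power2_norm_eq_inner[symmetric])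
  have wx: "w \<bullet> x = 0" by (simp add: w_def inner_diff_left xx l_def inner_commute[of "A *v x"])
  have wAx: "w \<bullet> (A *v x) = w \<bullet> w"
    using wx by (simp add: w_def inner_diff_right)
  define K where "K = l * (w \<bullet> w) - ?f w"
  have K: "K \<ge> 0" using le[OF wS] by (simp add: K_def)
  have "2 * (w \<bullet> w) \<le> t * K" if "t > 0" for t
  proof -
    have le: "?f (x + t *\<^sub>R w) \<le> l * ((x + t *\<^sub>R w) \<bullet> (x + t *\<^sub>R w))"
      by (intro le subspace_add subspace_scale S x wS)
    have fz: "?f (x + t *\<^sub>R w) = l + 2 * t * (w \<bullet> w) + t * t * ?f w"
      using sym_inner[OF sym, of x w] wAx
      by (simp add: matrix_vector_right_distrib matrix_vector_mult_scaleR inner_add_left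
          inner_add_right l_def inner_commute algebra_simps)
    have zz: "(x + t *\<^sub>R w) \<bullet> (x + t *\<^sub>R w) = 1 + t * t * (w \<bullet> w)"
      using wx by (simp add: inner_add_left inner_add_right xx inner_commute algebra_simps)
    have "t * (2 * (w \<bullet> w)) \<le> t * (t * K)"
      using le unfolding fz zz by (simp add: K_def algebra_simps)
    then show ?thesis using that by (simp only: mult_le_cancel_left_pos)
  qed
  note bound = this
  have "w \<bullet> w = 0"
  \<comment> \<open>If \<open>w\<close> were nonzero, this \<open>t\<close> would be so small that the quadratic term cannot compensate.\<close>
  proof (rule ccontr)
    assume "w \<bullet> w \<noteq> 0"
    then have pos: "w \<bullet> w > 0" by simp
    then have "(w \<bullet> w) / (K + 1) * K < 2 * (w \<bullet> w)"
      using K by (simp add: divide_simps)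
    moreover have "2 * (w \<bullet> w) \<le> (w \<bullet> w) / (K + 1) * K"
      using bound[of "(w \<bullet> w) / (K + 1)"] pos K by simp
    ultimately show False by simp
  qed
  then have "A *v x = l *\<^sub>R x" by (simp add: w_def)
  then show thesis using that x by (simp add: l_def)
qed

text \<open>
  The orthogonal complement of an eigenvector in \<open>S\<close> is again invariant, by symmetry of \<open>A\<close>, and its
  dimension is smaller by one.
\<close>

lemma symmetric_eigenbasis:
  fixes A :: "real^'n^'n"
  assumes sym: "transpose A = A" and "subspace S" "\<And>x. x \<in> S \<Longrightarrow> A *v x \<in> S"
  shows "\<exists>B\<subseteq>S. finite B \<and> pairwise orthogonal B \<and> card B = dim S \<and>
    (\<forall>b\<in>B. norm b = 1 \<and> A *v b = (b \<bullet> (A *v b)) *\<^sub>R b)"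
  using assms(2-3)
proof (induction "dim S" arbitrary: S)
  case 0
  then show ?case by (intro exI[of _ "{}"]) auto
next
  case (Suc d)
  have "S \<noteq> {0}" using Suc(2) by auto
  then obtain x where x: "x \<in> S" "norm x = 1" "A *v x = (x \<bullet> (A *v x)) *\<^sub>R x"
    using symmetric_has_eigenvector[OF sym Suc.prems(1)] Suc.prems(2) by metis
  define T where "T = {y \<in> S. \<forall>z \<in> span {x}. orthogonal z y}"
  have x0: "x \<noteq> 0" using x(2) by auto
  have T: "subspace T"
    unfolding T_def using Suc.prems(1)
    by (auto simp: subspace_def orthogonal_def inner_add_right)
  have Tx: "x \<bullet> y = 0" if "y \<in> T" for y
    using that unfolding T_def by (auto simp: orthogonal_def intro: span_base)
  have "span {x} \<subseteq> S" using x(1) Suc.prems(1) by (simp add: span_minimal)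
  then have "dim T + dim (span {x}) = dim S"
    unfolding T_def by (intro dim_subspace_orthogonal_to_vectors Suc.prems(1)) auto
  then have dimT: "d = dim T" using Suc(2) x0 by (simp add: dim_singleton)
  have AT: "A *v y \<in> T" if "y \<in> T" for y
  proof -
    have "x \<bullet> (A *v y) = (A *v x) \<bullet> y" by (rule sym_inner[OF sym])
    also have "\<dots> = (x \<bullet> (A *v x)) * (x \<bullet> y)" by (subst x(3)) simp
    finally have "x \<bullet> (A *v y) = 0" using Tx[OF that] by simp
    then show ?thesis
      using that Suc.prems(2) unfolding T_def by (auto simp: span_singleton orthogonal_def)
  qed
  obtain B where B: "B \<subseteq> T" "finite B" "pairwise orthogonal B" "card B = dim T"
     "\<forall>b\<in>B. norm b = 1 \<and> A *v b = (b \<bullet> (A *v b)) *\<^sub>R b"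
    using Suc.hyps(1)[OF dimT T AT] by blast
  have "x \<notin> B" using Tx[of x] B(1) x0 by auto
  then have "card (insert x B) = dim S" using B dimT Suc(2) by simp
  moreover have "pairwise orthogonal (insert x B)"
    using B(1,3) Tx by (auto simp: pairwise_insert orthogonal_def inner_commute)
  moreover have "insert x B \<subseteq> S" using x(1) B(1) by (auto simp: T_def)
  ultimately show ?case using B x by (intro exI[of _ "insert x B"]) auto
qed

text \<open>
  The subspace is the whole space for positive definite matrices and the range for positive semidefinite
  matrices of fixed rank. Its dimension has to be the cardinality of an index type because the
  eigenvectors become the columns of a matrix.
\<close>

lemma symmetric_diagonalizable_on:
  fixes A :: "real^'n^'n"
  assumes sym: "transpose A = A" and S: "subspace S" and inv: "\<And>x. x \<in> S \<Longrightarrow> A *v x \<in> S"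
    and dim: "dim S = CARD('k::finite)"
  obtains Q :: "real^'k^'n" and D where "Q \<in> stiefel" "diagonal_mat D" "A ** Q = Q ** D"
    "range ((*v) Q) = S"
proof -
  obtain B where B: "B \<subseteq> S" "finite B" "pairwise orthogonal B" "card B = CARD('k)"
     "\<And>b. b \<in> B \<Longrightarrow> norm b = 1" "\<And>b. b \<in> B \<Longrightarrow> A *v b = (b \<bullet> (A *v b)) *\<^sub>R b"
    using symmetric_eigenbasis[OF sym S inv] dim by metis
  obtain e :: "'k \<Rightarrow> real^'n" where e: "bij_betw e UNIV B"
    using B(2,4) by (metis finite_same_card_bij finite_class.finite_UNIV)
  define Q where "Q = (\<chi> i j. e j $ i)"
  define D where "D = (\<chi> i j. if i = j then e j \<bullet> (A *v e j) else 0)"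
  have eB: "e j \<in> B" for j using e by (auto simp: bij_betw_def)
  have ee: "e i \<bullet> e j = (if i = j then 1 else 0)" for i j
  proof (cases "i = j")
    case True then show ?thesis using B(5)[OF eB[of j]] by (simp add: power2_norm_eq_inner[symmetric])
  next
    case False
    then have "e i \<noteq> e j" using e by (auto simp: bij_betw_def inj_def)
    then show ?thesis using B(3) eB False by (auto simp: pairwise_def orthogonal_def)
  qed
  have col: "Q *v axis j 1 = e j" for j
    by (simp add: matrix_vector_mul_component Q_def vec_eq_iff inner_axis' matrix_vector_mult_def axis_def
         if_distrib cong: if_cong)
  have Q: "Q \<in> stiefel"
    unfolding stiefel_def
    by (simp add: vec_eq_iff matrix_matrix_mult_def transpose_def Q_def mat_def ee[unfolded inner_vec_def, simplified])
  have AQ: "A ** Q = Q ** D"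
  proof -
    have "(A ** Q) $ i $ j = (A *v e j) $ i" for i j
      by (simp add: matrix_matrix_mult_def matrix_vector_mult_def Q_def)
    moreover have "(Q ** D) $ i $ j = (A *v e j) $ i" for i j
      by (subst B(6)[OF eB]) (simp add: matrix_matrix_mult_def Q_def D_def if_distrib cong: if_cong)
    ultimately show ?thesis by (simp add: vec_eq_iff)
  qed
  have "0 \<notin> B" using B(5)[of 0] by auto
  then have ind: "independent B" using B(3) by (rule pairwise_orthogonal_independent[rotated])
  have spanB: "span B = S"
    using card_ge_dim_independent[OF B(1) ind] dim B(1,4) S by (metis order_refl span_minimal subset_antisym)
  have "range ((*v) Q) = S"
  proof
    have "B \<subseteq> range ((*v) Q)" using col e by (metis bij_betw_imp_surj_on image_subsetI rangeI)
    then show "S \<subseteq> range ((*v) Q)"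
      unfolding spanB[symmetric]
      by (intro span_minimal) (auto intro: linear_subspace_image[OF matrix_vector_mul_linear])
    have "Q *v x = (\<Sum>j\<in>UNIV. x $ j *\<^sub>R e j)" for x
      by (simp add: vec_eq_iff matrix_vector_mult_def Q_def mult.commute)
    then show "range ((*v) Q) \<subseteq> S"
      using B(1) eB by (auto intro!: subspace_sum subspace_scale S)
  qed
  moreover have "diagonal_mat D" by (simp add: diagonal_mat_def D_def)
  ultimately show thesis using that Q AQ by blast
qed

lemma diagonal_pos_spd:
  assumes "diagonal_mat D" "\<And>i. D $ i $ i > 0" shows "D \<in> spd_mats"
proof -
  have Dx: "D *v x = (\<chi> i. D $ i $ i * x $ i)" for x
  proof -
    have "(\<Sum>j\<in>UNIV. D $ i $ j * x $ j) = (\<Sum>j\<in>UNIV. if i = j then D $ i $ i * x $ i else 0)" for i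
      using assms(1) by (intro sum.cong) (auto simp: diagonal_mat_def)
    then show ?thesis by (simp add: vec_eq_iff matrix_vector_mult_def)
  qed
  have "x \<bullet> (D *v x) > 0" if x: "x \<noteq> 0" for x
  proof -
    obtain i where i: "x $ i \<noteq> 0" using x by (metis vec_eq_iff zero_index)
    have nn: "x $ j * (D $ j $ j * x $ j) \<ge> 0" for j
      using assms(2)[of j] by (metis less_imp_le mult.left_commute mult_nonneg_nonneg zero_le_square)
    have "x $ i * (D $ i $ i * x $ i) > 0"
      using assms(2)[of i] i by (metis mult.left_commute mult_pos_pos not_square_less_zero linorder_neqE_linordered_idom mult_eq_0_iff)
    then have "(\<Sum>j\<in>UNIV. x $ j * (D $ j $ j * x $ j)) > 0"
      using nn by (intro sum_pos2[of _ i]) auto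
    then show ?thesis by (simp add: Dx inner_vec_def)
  qed
  moreover have "transpose D = D"
    using assms(1) by (simp add: diagonal_mat_def transpose_def vec_eq_iff) metis
  ultimately show ?thesis by (simp add: spd_mats_def sym_mats_def)
qed

lemma stiefelD: "Q \<in> stiefel \<Longrightarrow> transpose Q ** Q = mat 1"
  by (simp add: stiefel_def)

lemma stiefel_cancel:
  assumes "Q \<in> stiefel" shows "X ** transpose Q ** Q = X"
  by (metis assms stiefelD matrix_mul_assoc matrix_mul_rid)

lemma stiefel_square_orthogonal:
  fixes G :: "real^'k^'k" shows "G \<in> stiefel \<longleftrightarrow> orthogonal_matrix G"
  by (simp add: stiefel_def orthogonal_matrix)

lemma spd_diagonalize:
  fixes M :: "real^'k^'k"
  assumes "M \<in> spd_mats"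
  obtains P D where "orthogonal_matrix P" "diagonal_mat D" "D \<in> spd_mats" "M = P ** D ** transpose P"
proof -
  obtain P :: "real^'k^'k" and D where P: "P \<in> stiefel" "diagonal_mat D" "M ** P = P ** D"
    using symmetric_diagonalizable_on[OF spd_matsD(1)[OF assms] subspace_UNIV, where 'k = 'k]
    by (metis UNIV_I dim_UNIV DIM_cart DIM_real mult.right_neutral)
  then have o: "orthogonal_matrix P" by (simp add: stiefel_square_orthogonal)
  have M: "M = P ** D ** transpose P"
    by (metis P(3) matrix_mul_assoc matrix_mul_rid o orthogonal_matrixD(2))
  have "D = transpose P ** M ** P"
    by (metis P(1,3) matrix_mul_assoc matrix_mul_lid stiefelD)
  then have "D \<in> spd_mats" using spd_conjugate[OF assms o] by simp
  then show thesis using that P o M by blast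
qed

section \<open>The square root of a positive definite matrix\<close>

lemma spd_sqrt_exists:
  fixes M :: "real^'k^'k"
  assumes "M \<in> spd_mats" shows "\<exists>R\<in>spd_mats. R ** R = M"
proof -
  obtain P D where P: "orthogonal_matrix P" "diagonal_mat D" "D \<in> spd_mats" "M = P ** D ** transpose P"
    using spd_diagonalize[OF assms] by blast
  define E where "E = (\<chi> i j. sqrt (D $ i $ j))"
  have pos: "D $ i $ i > 0" for i
  proof -
    have "D $ i $ i = axis i 1 \<bullet> (D *v axis i 1)"
      by (simp add: inner_axis' matrix_vector_mult_basis column_def)
    then show ?thesis using spd_matsD(2)[OF P(3), of "axis i 1"] by simp
  qed
  have dE: "diagonal_mat E" using P(2) by (simp add: diagonal_mat_def E_def)
  then have E: "E \<in> spd_mats" using pos by (intro diagonal_pos_spd) (auto simp: E_def)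
  have EE: "E ** E = D"
  proof -
    have "(E ** E) $ i $ j = D $ i $ j" for i j
    proof -
      have "(E ** E) $ i $ j = (\<Sum>l\<in>UNIV. if l = i then E $ i $ i * E $ i $ j else 0)"
        unfolding matrix_matrix_mult_def using dE
        by (simp add: diagonal_mat_def del: sum.delta) (rule sum.cong, auto)
      also have "\<dots> = D $ i $ j"
        using P(2) pos[of i] by (cases "i = j") (auto simp: E_def diagonal_mat_def)
      finally show ?thesis .
    qed
    then show ?thesis by (simp add: vec_eq_iff)
  qed
  let ?R = "P ** E ** transpose P"
  have "orthogonal_matrix (transpose P)" using P(1) by (simp add: orthogonal_matrix_def)
  then have "?R \<in> spd_mats" using spd_conjugate[OF E, of "transpose P"] by simp
  moreover have "?R ** ?R = M"
    using P(1) by (simp add: P(4) EE[symmetric] matrix_mul_assoc stiefel_cancel stiefel_square_orthogonal)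
  ultimately show ?thesis by blast
qed

definition msqrt :: "real^'k^'k \<Rightarrow> real^'k^'k" where
  "msqrt M = (SOME R. R \<in> spd_mats \<and> R ** R = M)"

lemma msqrt:
  assumes "M \<in> spd_mats"
  shows msqrt_spd: "msqrt M \<in> spd_mats" and msqrt_square: "msqrt M ** msqrt M = M"
  using someI_ex[of "\<lambda>R. R \<in> spd_mats \<and> R ** R = M"] spd_sqrt_exists[OF assms]
  unfolding msqrt_def by auto

text \<open>
  From \<open>R' R' - R R = R' d + d R\<close> with \<open>d = R' - R\<close>, paired with \<open>d\<close>: the first term contributes a
  nonnegative number, the second one at least \<open>c\<close> times the squared norm of \<open>d\<close>. So the square root
  is locally Lipschitz, and positive definite square roots are unique.
\<close>

lemma norm_spd_diff_le_square_diff: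
  assumes R: "R \<in> spd_mats"
  obtains c where "c > 0"
    "\<And>R'. R' \<in> spd_mats \<Longrightarrow> c * norm (R' - R) \<le> norm (R' ** R' - R ** (R :: real^'k^'k))"
proof -
  obtain c where c: "c > 0" "\<And>C :: real^'k^'k. c * (norm C)\<^sup>2 \<le> C \<bullet> (C ** R)"
    using spd_coercive[OF R] by blast
  show thesis
  proof (rule that[OF c(1)])
    fix R' :: "real^'k^'k" assume R': "R' \<in> spd_mats"
    let ?d = "R' - R"
    have "R' ** R' - R ** R = R' ** ?d + ?d ** R" by (simp add: matrix_simps)
    moreover have "?d \<bullet> (R' ** ?d) \<ge> 0"
    proof -
      have "x \<bullet> (R' *v x) \<ge> 0" for x
        using spd_matsD(2)[OF R', of x] by (cases "x = 0") auto
      then show ?thesis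
        by (subst inner_mult_left[OF spd_matsD(1)[OF R']]) (rule inner_mult_right_nonneg)
    qed
    ultimately have "c * (norm ?d)\<^sup>2 \<le> ?d \<bullet> (R' ** R' - R ** R)"
      using c(2)[of ?d] by (simp add: inner_add_right)
    also have "\<dots> \<le> norm ?d * norm (R' ** R' - R ** R)" by (rule norm_cauchy_schwarz)
    finally show "c * norm ?d \<le> norm (R' ** R' - R ** R)"
      by (cases "norm ?d = 0") (simp_all add: power2_eq_square mult.left_commute)
  qed
qed

text \<open>
  With \<open>d\<close> the increment of the root, \<open>N - M = R d + d R + d d\<close>, so \<open>d\<close> solves the Sylvester equation up
  to the term \<open>d d\<close>, which is quadratically small by the Lipschitz bound.
\<close>

lemma has_derivative_msqrt:
  assumes M: "(M :: real^'k^'k) \<in> spd_mats"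
  shows "(msqrt has_derivative sylvester (msqrt M)) (at M within spd_mats)"
proof -
  define R where "R = msqrt M"
  have R: "R \<in> spd_mats" "R ** R = M" using msqrt[OF M] by (simp_all add: R_def)
  have bl: "bounded_linear (sylvester R)"
    using linear_sylvester[OF R(1)] by (simp add: linear_conv_bounded_linear)
  obtain c where c: "c > 0" "\<And>R'. R' \<in> spd_mats \<Longrightarrow> c * norm (R' - R) \<le> norm (R' ** R' - R ** R)"
    using norm_spd_diff_le_square_diff[OF R(1)] by blast
  obtain Ks where Ks: "Ks > 0" "\<And>B. norm (sylvester R B) \<le> norm B * Ks"
    using bounded_linear.pos_bounded[OF bl] by blast
  obtain K where K: "K > 0" "\<And>(A :: real^'k^'k) (B :: real^'k^'k). norm (A ** B) \<le> norm A * norm B * K"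
    using matrix_mult.pos_bounded by blast
  have "(msqrt has_derivative sylvester R) (at M within spd_mats)"
  proof (rule has_derivativeI_sandwich[OF zero_less_one bl])
    fix N assume N: "N \<in> spd_mats" "N \<noteq> M"
    define d where "d = msqrt N - R"
    define n where "n = norm (N - M)"
    have n: "n > 0" using N(2) by (simp add: n_def)
    have d: "norm d \<le> n / c"
      using c(2)[OF msqrt_spd[OF N(1)]] c(1)
      by (simp add: msqrt_square[OF N(1)] R(2) d_def n_def pos_le_divide_eq mult.commute)
    have "N - M = R ** d + d ** R + d ** d"
      by (simp add: d_def R(2)[symmetric] matrix_simps msqrt_square[OF N(1)])
    then have "sylvester R (N - M - d ** d) = d" by (intro sylvester_unique R(1)) simp
    then have "d - sylvester R (N - M) = - sylvester R (d ** d)"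
      unfolding linear_diff[OF linear_sylvester[OF R(1)], of _ "d ** d"] by (simp add: algebra_simps)
    then have "norm (d - sylvester R (N - M)) \<le> norm (d ** d) * Ks" using Ks(2) by simp
    also have "\<dots> \<le> (norm d * norm d * K) * Ks"
      using K(2) Ks(1) by (intro mult_right_mono) auto
    also have "\<dots> \<le> (n / c * (n / c) * K) * Ks"
      using d K(1) Ks(1) n c(1) by (intro mult_right_mono mult_mono) auto
    finally have "norm (d - sylvester R (N - M)) / n \<le> n * (K * Ks / (c * c))"
      using n c(1) by (simp add: pos_divide_le_eq mult.commute mult.left_commute)
    then show "norm (msqrt N - msqrt M - sylvester R (N - M)) / norm (N - M)
        \<le> norm (N - M) * (K * Ks / (c * c))"
      by (simp add: d_def n_def R_def)
  next
    have "((\<lambda>N. norm (N - M) * (K * Ks / (c * c))) \<longlongrightarrow> norm (M - M) * (K * Ks / (c * c)))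
        (at M within spd_mats)"
      by (intro tendsto_intros)
    then show "((\<lambda>N. norm (N - M) * (K * Ks / (c * c))) \<longlongrightarrow> 0) (at M within spd_mats)" by simp
  qed
  then show ?thesis by (simp add: R_def)
qed

text \<open>
  The derivative is a Sylvester solution whose coefficient is the square root itself, so a square root
  of class \<open>r\<close> has a derivative of class \<open>r\<close>.
\<close>

lemma Cr_on_msqrt:
  assumes "open U" "\<And>x. x \<in> U \<Longrightarrow> f x \<in> spd_mats" "Cr_on r U f"
  shows "Cr_on r U (\<lambda>x. msqrt (f x))"
  using assms(3)
proof (induction r)
  case 0
  have "continuous_on spd_mats msqrt"
    by (rule has_derivative_continuous_on[OF has_derivative_msqrt])
  then show ?case
    using continuous_on_compose2[of spd_mats msqrt U f] 0 assms(2) by auto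
next
  case (Suc r)
  have sub: "f ` U \<subseteq> spd_mats" using assms(2) by auto
  have "((\<lambda>x. msqrt (f x)) has_derivative (\<lambda>v. sylvester (msqrt (f x)) (frechet_derivative f (at x) v))) (at x)"
    if x: "x \<in> U" for x
    using has_derivative_in_compose2[OF has_derivative_msqrt sub x, of "frechet_derivative f (at x)"]
      Cr_on_SucD_has_derivative[OF Suc.prems x] at_within_open[OF x \<open>open U\<close>] by simp
  then show ?case
  proof (rule Cr_on_SucI[OF \<open>open U\<close>])
    show "Cr_on r U (\<lambda>x. sylvester (msqrt (f x)) (frechet_derivative f (at x) v))" for v
    proof (rule Cr_on_sylvester[OF \<open>open U\<close> msqrt_spd[OF assms(2)] Suc.IH[OF Cr_on_SucD[OF Suc.prems]]])
      show "Cr_on r U (\<lambda>x. frechet_derivative f (at x) v)" using Suc.prems by simp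
    qed
  qed
qed

section \<open>Factorisations of positive semidefinite matrices of fixed rank\<close>

text \<open>
  Both Stiefel matrices have the range of the common product as their column space. Multiplying the
  equation by \<open>Q\<^sub>2\<close> from the right and cancelling \<open>D\<^sub>2\<close> exhibits the matrix \<open>G\<close> of the change of
  orthonormal basis.
\<close>

lemma factorization_unique:
  fixes Q\<^sub>1 Q\<^sub>2 :: "real^'k^'n"
  assumes Q: "Q\<^sub>1 \<in> stiefel" "Q\<^sub>2 \<in> stiefel" and D: "D\<^sub>1 \<in> spd_mats" "D\<^sub>2 \<in> spd_mats"
    and eq: "Q\<^sub>1 ** D\<^sub>1 ** transpose Q\<^sub>1 = Q\<^sub>2 ** D\<^sub>2 ** transpose Q\<^sub>2"
  obtains G where "orthogonal_matrix G" "Q\<^sub>2 = Q\<^sub>1 ** G" "D\<^sub>2 = transpose G ** D\<^sub>1 ** G"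
proof -
  obtain E where E: "D\<^sub>2 ** E = mat 1" using spd_invertible[OF D(2)] by metis
  define G where "G = D\<^sub>1 ** transpose Q\<^sub>1 ** Q\<^sub>2 ** E"
  have "Q\<^sub>2 = Q\<^sub>2 ** D\<^sub>2 ** transpose Q\<^sub>2 ** Q\<^sub>2 ** E"
    using E Q(2) by (simp add: stiefel_cancel) (metis matrix_mul_assoc matrix_mul_rid)
  also have "\<dots> = Q\<^sub>1 ** G" by (simp add: eq[symmetric] G_def matrix_mul_assoc)
  finally have Q2: "Q\<^sub>2 = Q\<^sub>1 ** G" .
  have "transpose G ** G = transpose G ** transpose Q\<^sub>1 ** Q\<^sub>1 ** G"
    using Q(1) by (simp add: stiefel_cancel)
  also have "\<dots> = mat 1"
    using stiefelD[OF Q(2)] by (simp add: Q2 matrix_simps)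
  finally have "orthogonal_matrix G" by (simp add: orthogonal_matrix)
  moreover have "D\<^sub>2 = transpose G ** D\<^sub>1 ** G"
  proof -
    have "D\<^sub>2 = transpose Q\<^sub>2 ** (Q\<^sub>2 ** D\<^sub>2 ** transpose Q\<^sub>2) ** Q\<^sub>2"
      using Q(2) by (simp add: matrix_mul_assoc stiefelD stiefel_cancel)
    also have "\<dots> = transpose G ** (transpose Q\<^sub>1 ** Q\<^sub>1) ** D\<^sub>1 ** (transpose Q\<^sub>1 ** Q\<^sub>1) ** G"
      by (simp add: eq[symmetric]) (simp add: Q2 matrix_simps)
    finally show ?thesis by (simp add: stiefelD[OF Q(1)])
  qed
  ultimately show thesis using that Q2 by blast
qed

lemma stiefel_mult_orthogonal:
  assumes "Q \<in> stiefel" "orthogonal_matrix G" shows "Q ** G \<in> stiefel"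
  using assms by (simp add: stiefel_def matrix_simps)
    (metis matrix_mul_assoc matrix_mul_rid orthogonal_matrixD(1))

text \<open>
  Diagonalise \<open>A\<close> on its range. The eigenvalues there are nonnegative, and none of them is zero because
  a symmetric matrix is injective on its range.
\<close>

lemma psd_factorization:
  fixes A :: "real^'n^'n"
  assumes "A \<in> spsd_rank CARD('k::finite)"
  obtains Q :: "real^'k^'n" and D where "Q \<in> stiefel" "D \<in> spd_mats" "A = Q ** D ** transpose Q"
proof -
  have A: "transpose A = A" "\<And>x. x \<bullet> (A *v x) \<ge> 0" "rank A = CARD('k)"
    using assms by (auto simp: spsd_rank_def sym_mats_def)
  let ?S = "range ((*v) A)"
  have "subspace ?S" by (intro linear_subspace_image[OF matrix_vector_mul_linear] subspace_UNIV)
  then obtain Q :: "real^'k^'n" and D where Q: "Q \<in> stiefel" "diagonal_mat D" "A ** Q = Q ** D"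
    "range ((*v) Q) = ?S"
    using symmetric_diagonalizable_on[OF A(1), of ?S, where 'k = 'k] A(3) by (auto simp: rank_dim_range)
  have D: "D = transpose Q ** A ** Q"
    by (metis Q(1,3) matrix_mul_assoc matrix_mul_lid stiefelD)
  have AQQ: "A ** Q ** transpose Q = A"
  proof -
    \<comment> \<open>\<open>Q Q\<^sup>T\<close> projects onto the range of \<open>A\<close>, so it fixes the columns of \<open>A\<close>, by symmetry also the rows.\<close>
    have "Q ** transpose Q ** A = A"
    proof (subst matrix_eq, intro allI)
      fix x
      obtain z where "A *v x = Q *v z" using Q(4) by (metis imageE rangeI)
      then show "(Q ** transpose Q ** A) *v x = A *v x"
        by (metis Q(1) matrix_vector_mul_assoc matrix_vector_mul_lid stiefelD)
    qed
    then have "transpose (Q ** transpose Q ** A) = transpose A" by simp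
    then show ?thesis by (simp add: matrix_simps A(1))
  qed
  have "D $ i $ i > 0" for i
  proof -
    let ?q = "Q *v axis i 1"
    have Dii: "D $ i $ i = axis i 1 \<bullet> (D *v axis i 1)"
      by (simp add: inner_axis' matrix_vector_mult_basis column_def)
    also have "\<dots> = ?q \<bullet> (A *v ?q)" by (simp only: D inner_conjugate)
    finally have ge: "D $ i $ i \<ge> 0" using A(2) by simp
    have "D $ i $ i \<noteq> 0"
    proof
      assume 0: "D $ i $ i = 0"
      have "D *v axis i 1 = 0"
        using Q(2) 0 by (auto simp: matrix_vector_mult_basis column_def diagonal_mat_def vec_eq_iff) metis
      then have Aq: "A *v ?q = 0"
        by (metis Q(3) matrix_vector_mul_assoc matrix_vector_mult_0_right)
      obtain z where z: "?q = A *v z" using Q(4) by (metis imageE rangeI)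
      have "?q \<bullet> ?q = (A *v ?q) \<bullet> z" by (subst (2) z) (rule sym_inner[OF A(1)])
      then have "?q = 0" using Aq by simp
      then have "axis i 1 = (0 :: real^'k)"
        by (metis Q(1) matrix_vector_mul_assoc matrix_vector_mul_lid matrix_vector_mult_0_right stiefelD)
      then show False by simp
    qed
    then show ?thesis using ge by simp
  qed
  then have "D \<in> spd_mats" by (rule diagonal_pos_spd[OF Q(2)])
  moreover have "A = Q ** D ** transpose Q" using AQQ by (simp add: Q(3)[symmetric])
  ultimately show thesis using that Q(1) by blast
qed

lemma factorization_psd:
  fixes Q :: "real^'k^'n"
  assumes Q: "Q \<in> stiefel" and D: "D \<in> spd_mats"
  shows "Q ** D ** transpose Q \<in> spsd_rank CARD('k)"
proof -
  let ?A = "Q ** D ** transpose Q"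
  have "x \<bullet> (?A *v x) \<ge> 0" for x
    using inner_conjugate[of x "transpose Q" D] spd_matsD(2)[OF D, of "transpose Q *v x"]
    by (cases "transpose Q *v x = 0") auto
  moreover have "rank ?A = CARD('k)"
  proof (rule antisym)
    have "rank ?A \<le> rank (Q ** D)" by (rule rank_mul_le_left)
    also have "\<dots> \<le> rank D" by (rule rank_mul_le_right)
    finally show "rank ?A \<le> CARD('k)" using rank_bound[of D] by simp
    obtain E where E: "D ** E = mat 1" using spd_invertible[OF D] by metis
    have "mat 1 = transpose Q ** (?A ** (Q ** E))"
      using Q E by (simp add: matrix_mul_assoc stiefel_cancel stiefelD)
    then have "CARD('k) \<le> rank (?A ** (Q ** E))"
      by (metis rank_I rank_mul_le_right)
    also have "\<dots> \<le> rank ?A" by (rule rank_mul_le_left)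
    finally show "CARD('k) \<le> rank ?A" .
  qed
  ultimately show ?thesis
    by (simp add: spsd_rank_def sym_mats_def matrix_simps spd_matsD[OF D])
qed

section \<open>The Bures--Wasserstein metric in terms of a factorisation\<close>

text \<open>
  The nullspace of \<open>Q D Q\<^sup>T\<close> is that of \<open>Q\<^sup>T\<close>, because \<open>Q D\<close> has a left inverse.
\<close>

lemma null_projector_factorization:
  fixes Q :: "real^'k^'n"
  assumes Q: "Q \<in> stiefel" and D: "D \<in> spd_mats"
  shows "null_projector (Q ** D ** transpose Q) = mat 1 - Q ** transpose Q"
proof -
  let ?A = "Q ** D ** transpose Q" and ?P = "mat 1 - Q ** transpose Q"
  have AP: "?A ** ?P = 0" using Q by (simp add: matrix_simps stiefel_cancel)
  have ker: "transpose Q *v y = 0" if y: "?A *v y = 0" for y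
  proof -
    obtain E where E: "E ** D = mat 1" using spd_invertible[OF D] by metis
    have "transpose Q = E ** (transpose Q ** Q) ** D ** transpose Q"
      using Q E by (simp add: stiefelD)
    also have "\<dots> = E ** transpose Q ** ?A" by (simp only: matrix_mul_assoc)
    finally show ?thesis
      using y by (metis matrix_vector_mul_assoc matrix_vector_mult_0_right)
  qed
  have P: "?A *v (?P *v x) = 0 \<and> (\<forall>y. ?A *v y = 0 \<longrightarrow> (x - ?P *v x) \<bullet> y = 0)" for x
  proof (intro conjI allI impI)
    show "?A *v (?P *v x) = 0" by (simp add: matrix_vector_mul_assoc AP)
    fix y assume y: "?A *v y = 0"
    have "x - ?P *v x = Q *v (transpose Q *v x)"
      by (simp add: matrix_vector_mult_diff_rdistrib matrix_vector_mul_assoc del: transpose_matrix_vector)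
    also have "\<dots> \<bullet> y = (transpose Q *v x) \<bullet> (transpose Q *v y)"
      by (metis dot_lmul_matrix inner_commute vector_transpose_matrix transpose_transpose)
    finally show "(x - ?P *v x) \<bullet> y = 0" by (simp add: ker[OF y] del: transpose_matrix_vector)
  qed
  show ?thesis
    unfolding null_projector_def
  proof (rule the_equality)
    show "\<forall>x. ?A *v (?P *v x) = 0 \<and> (\<forall>y. ?A *v y = 0 \<longrightarrow> (x - ?P *v x) \<bullet> y = 0)"
      using P by blast
    fix P' assume P': "\<forall>x. ?A *v (P' *v x) = 0 \<and> (\<forall>y. ?A *v y = 0 \<longrightarrow> (x - P' *v x) \<bullet> y = 0)"
    have "P' *v x = ?P *v x" for x
    proof -
      let ?d = "P' *v x - ?P *v x"
      have Ad: "?A *v ?d = 0" using P[of x] P' by (simp add: matrix_vector_mult_diff_distrib)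
      have "?d \<bullet> ?d = (x - ?P *v x) \<bullet> ?d - (x - P' *v x) \<bullet> ?d" by (simp add: inner_diff_left)
      also have "\<dots> = 0" using P[of x] P' Ad by simp
      finally show ?thesis by simp
    qed
    then show "P' = ?P" by (simp add: matrix_eq)
  qed
qed

text \<open>
  \<open>A X\<close> and \<open>A Y\<close> are orthogonal projectors with the same range, \<open>X A\<close> and \<open>Y A\<close> orthogonal
  projectors with the same kernel.
\<close>

lemma moore_penrose_unique:
  fixes A X Y :: "real^'n^'n"
  assumes X: "A ** X ** A = A" "X ** A ** X = X" "transpose (A ** X) = A ** X" "transpose (X ** A) = X ** A"
    and Y: "A ** Y ** A = A" "Y ** A ** Y = Y" "transpose (A ** Y) = A ** Y" "transpose (Y ** A) = Y ** A"
  shows "X = Y"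
proof -
  have "A ** X = (A ** Y) ** (A ** X)" by (simp add: matrix_mul_assoc Y(1))
  also have "\<dots> = transpose ((A ** X) ** (A ** Y))" by (simp only: matrix_transpose_mul[of "A ** X"] X(3) Y(3))
  also have "\<dots> = A ** Y" by (simp add: matrix_mul_assoc X(1) Y(3))
  finally have AX: "A ** X = A ** Y" .
  have "X ** A = (X ** A) ** (Y ** A)" by (metis matrix_mul_assoc Y(1))
  also have "\<dots> = transpose ((Y ** A) ** (X ** A))" by (simp only: matrix_transpose_mul[of "Y ** A"] X(4) Y(4))
  also have "(Y ** A) ** (X ** A) = Y ** A" by (metis matrix_mul_assoc X(1))
  finally have XA: "X ** A = Y ** A" by (simp add: Y(4))
  have "X = X ** (A ** Y)" by (metis AX X(2) matrix_mul_assoc)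
  also have "\<dots> = Y" by (simp add: matrix_mul_assoc XA Y(2))
  finally show ?thesis .
qed

lemma moore_penrose_factorization:
  fixes Q :: "real^'k^'n"
  assumes Q: "Q \<in> stiefel" and D: "transpose D = D" "D ** E = mat 1" "E ** D = mat 1" "transpose E = E"
  shows "moore_penrose (Q ** D ** transpose Q) = Q ** E ** transpose Q"
proof -
  let ?A = "Q ** D ** transpose Q" and ?X = "Q ** E ** transpose Q"
  have "?A ** ?X ** ?A = ?A" "?X ** ?A ** ?X = ?X"
    "transpose (?A ** ?X) = ?A ** ?X" "transpose (?X ** ?A) = ?X ** ?A"
    using Q D by (simp_all add: matrix_simps stiefel_cancel inverse_cancel)
  note X = this
  show ?thesis
    unfolding moore_penrose_def
    by (rule the_equality) (use X in blast, metis moore_penrose_unique X)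
qed

text \<open>
  The definition ranges over diagonal \<open>D\<close>. Any factorisation can be brought to diagonal form by an
  orthogonal matrix, and any two factorisations differ by one; along such a change the expression is
  constant by \<open>sylvester_conjugate\<close>. So every factorisation computes the value.
\<close>

lemma bw_S_factorization:
  fixes Q :: "real^'k^'n"
  assumes Q: "Q \<in> stiefel" and D: "D \<in> spd_mats"
  shows "bw_S TYPE('k) (Q ** D ** transpose Q) V = Q ** sylvester D (transpose Q ** V ** Q) ** transpose Q"
  unfolding bw_S_def
proof (rule the_equality)
  have transform: "Q' ** sylvester D' (transpose Q' ** V ** Q') ** transpose Q'
      = Q ** sylvester D (transpose Q ** V ** Q) ** transpose Q"
    if G: "orthogonal_matrix G" "Q' = Q ** G" "D' = transpose G ** D ** G" for Q' D' and G :: "real^'k^'k"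
  proof -
    have "transpose Q' ** V ** Q' = transpose G ** (transpose Q ** V ** Q) ** G"
      by (simp add: G(2) matrix_simps)
    then show ?thesis
      unfolding G(3) by (simp only: sylvester_conjugate[OF D G(1)]) (simp add: G(2) matrix_simps orthogonal_cancel[OF G(1)])
  qed
  obtain P L where P: "orthogonal_matrix P" "diagonal_mat L" "L \<in> spd_mats" "D = P ** L ** transpose P"
    using spd_diagonalize[OF D] by blast
  have L: "L = transpose P ** D ** P"
    using P(1) by (simp add: P(4) matrix_mul_assoc stiefel_cancel orthogonal_matrixD stiefel_square_orthogonal)
  show "\<exists>Q' D'. Q' \<in> stiefel \<and> D' \<in> spd_mats \<and> diagonal_mat D' \<and>
      Q ** D ** transpose Q = Q' ** D' ** transpose Q' \<and>
      Q ** sylvester D (transpose Q ** V ** Q) ** transpose Q =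
      Q' ** sylvester D' (transpose Q' ** V ** Q') ** transpose (Q' :: real^'k^'n)"
    using P(2,3) stiefel_mult_orthogonal[OF Q P(1)] transform[OF P(1) refl L]
    by (intro exI[of _ "Q ** P"] exI[of _ L]) (simp add: P(4) matrix_simps)
next
  fix S
  assume "\<exists>Q' D'. (Q' :: real^'k^'n) \<in> stiefel \<and> D' \<in> spd_mats \<and> diagonal_mat D' \<and>
      Q ** D ** transpose Q = Q' ** D' ** transpose Q' \<and>
      S = Q' ** sylvester D' (transpose Q' ** V ** Q') ** transpose Q'"
  then obtain Q' :: "real^'k^'n" and D' where Q': "Q' \<in> stiefel" "D' \<in> spd_mats"
      "Q ** D ** transpose Q = Q' ** D' ** transpose Q'"
      "S = Q' ** sylvester D' (transpose Q' ** V ** Q') ** transpose Q'"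
    by blast
  obtain G where G: "orthogonal_matrix G" "Q' = Q ** G" "D' = transpose G ** D ** G"
    using factorization_unique[OF Q Q'(1) D Q'(2,3)] by blast
  have "transpose Q' ** V ** Q' = transpose G ** (transpose Q ** V ** Q) ** G"
    by (simp add: G(2) matrix_simps)
  then show "S = Q ** sylvester D (transpose Q ** V ** Q) ** transpose Q"
    unfolding Q'(4) G(3) by (simp only: sylvester_conjugate[OF D G(1)]) (simp add: G(2) matrix_simps orthogonal_cancel[OF G(1)])
qed

lemma bw_metric_factorization:
  fixes Q :: "real^'k^'n"
  assumes Q: "Q \<in> stiefel" and D: "D \<in> spd_mats" and E: "D ** E = mat 1" "E ** D = mat 1" "transpose E = E"
  shows "bw_metric TYPE('k) (Q ** D ** transpose Q) V W =
    trace (sylvester D (transpose Q ** V ** Q) ** D ** sylvester D (transpose Q ** W ** Q)) +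
    trace ((mat 1 - Q ** transpose Q) ** V ** Q ** E ** transpose Q ** W)"
proof -
  let ?S = "\<lambda>V. sylvester D (transpose Q ** V ** Q)"
  have "trace (Q ** ?S V ** transpose Q ** (Q ** D ** transpose Q) ** (Q ** ?S W ** transpose Q))
      = trace (Q ** (?S V ** D ** ?S W ** transpose Q))"
    using Q by (simp add: matrix_mul_assoc stiefel_cancel)
  also have "\<dots> = trace (?S V ** D ** ?S W)"
    by (subst trace_mul_sym) (simp add: stiefel_cancel[OF Q])
  finally show ?thesis
    unfolding bw_metric_def bw_S_factorization[OF Q D] null_projector_factorization[OF Q D]
      moore_penrose_factorization[OF Q spd_matsD(1)[OF D] E]
    by (simp add: matrix_mul_assoc)
qed

lemma bw_metric_add_left:
  fixes A :: "real^'n^'n"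
  assumes "A \<in> spsd_rank CARD('k::finite)"
  shows "bw_metric TYPE('k) A (V + V') W = bw_metric TYPE('k) A V W + bw_metric TYPE('k) A V' W"
proof -
  obtain Q :: "real^'k^'n" and D where Q: "Q \<in> stiefel" "D \<in> spd_mats" "A = Q ** D ** transpose Q"
    using psd_factorization[OF assms] by blast
  obtain E where E: "D ** E = mat 1" "E ** D = mat 1" "transpose E = E"
    using spd_invertible[OF Q(2)] by metis
  show ?thesis
    unfolding Q(3) bw_metric_factorization[OF Q(1,2) E]
    by (simp add: matrix_simps linear_add[OF linear_sylvester[OF Q(2)]] trace_add)
qed

lemma trace_scaleR: "trace (c *\<^sub>R A) = c * trace (A :: real^'n^'n)"
  by (simp add: trace_def sum_distrib_left)

lemma bw_metric_scale_left:
  fixes A :: "real^'n^'n"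
  assumes "A \<in> spsd_rank CARD('k::finite)"
  shows "bw_metric TYPE('k) A (c *\<^sub>R V) W = c * bw_metric TYPE('k) A V W"
proof -
  obtain Q :: "real^'k^'n" and D where Q: "Q \<in> stiefel" "D \<in> spd_mats" "A = Q ** D ** transpose Q"
    using psd_factorization[OF assms] by blast
  obtain E where E: "D ** E = mat 1" "E ** D = mat 1" "transpose E = E"
    using spd_invertible[OF Q(2)] by metis
  show ?thesis
    unfolding Q(3) bw_metric_factorization[OF Q(1,2) E]
    by (simp add: matrix_simps linear_scale[OF linear_sylvester[OF Q(2)]] trace_scaleR distrib_left)
qed

lemma bw_metric_sym:
  fixes A :: "real^'n^'n"
  assumes "A \<in> spsd_rank CARD('k::finite)" "V \<in> sym_mats" "W \<in> sym_mats"
  shows "bw_metric TYPE('k) A V W = bw_metric TYPE('k) A W V"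
proof -
  obtain Q :: "real^'k^'n" and D where Q: "Q \<in> stiefel" "D \<in> spd_mats" "A = Q ** D ** transpose Q"
    using psd_factorization[OF assms(1)] by blast
  obtain E where E: "D ** E = mat 1" "E ** D = mat 1" "transpose E = E"
    using spd_invertible[OF Q(2)] by metis
  have VW: "transpose V = V" "transpose W = W" using assms(2,3) by (auto simp: sym_mats_def)
  let ?S = "\<lambda>V. sylvester D (transpose Q ** V ** Q)"
  have "trace (?S V ** D ** ?S W) = trace (transpose (?S V ** D ** ?S W))"
    by (simp only: trace_transpose)
  also have "\<dots> = trace (?S W ** D ** ?S V)"
    by (simp add: matrix_simps transpose_sylvester Q(2) spd_matsD(1)[OF Q(2)] VW)
  finally have 1: "trace (?S V ** D ** ?S W) = trace (?S W ** D ** ?S V)" .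
  let ?P = "mat 1 - Q ** transpose Q"
  have P: "transpose ?P = ?P" by (simp add: matrix_simps)
  have "trace (?P ** V ** Q ** E ** transpose Q ** W)
      = trace (transpose (?P ** V ** Q ** E ** transpose Q ** W))"
    by (simp only: trace_transpose)
  also have "\<dots> = trace ((W ** Q ** E ** transpose Q ** V) ** ?P)"
    by (simp only: matrix_transpose_mul P VW E transpose_transpose matrix_mul_assoc)
  also have "\<dots> = trace (?P ** W ** Q ** E ** transpose Q ** V)"
    by (subst trace_mul_sym) (simp only: matrix_mul_assoc)
  finally show ?thesis
    unfolding Q(3) bw_metric_factorization[OF Q(1,2) E] using 1 by simp
qed

section \<open>The differential of the parametrisation\<close>

text \<open>
  The product rule for \<open>Q D Q\<^sup>T\<close>, where \<open>p = (Q, D)\<close> and \<open>a\<close> is the increment.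
\<close>

definition phi_diff :: "('n::finite, 'k::finite) mat_pair \<Rightarrow> ('n, 'k) mat_pair \<Rightarrow> real^'n^'n" where
  "phi_diff p a = fst a ** snd p ** transpose (fst p) + fst p ** snd a ** transpose (fst p)
     + fst p ** snd p ** transpose (fst a)"

lemma has_derivative_phi_lift:
  fixes p :: "('n::finite, 'k::finite) mat_pair"
  shows "(phi_lift has_derivative phi_diff p) (at p)"
proof -
  note mult = bounded_bilinear.FDERIV[OF bounded_bilinear_matrix_mult]
  have "((\<lambda>p :: ('n, 'k) mat_pair. fst p ** snd p ** transpose (fst p)) has_derivative
      (\<lambda>a. (fst p ** snd p) ** transpose (fst a) + (fst p ** snd a + fst a ** snd p) ** transpose (fst p)))
      (at p)"
    by (intro mult has_derivative_fst has_derivative_snd has_derivative_ident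
        bounded_linear.has_derivative[OF bounded_linear_transpose])
  moreover have "phi_lift = (\<lambda>p :: ('n, 'k) mat_pair. fst p ** snd p ** transpose (fst p))"
    by (simp add: fun_eq_iff phi_lift_def case_prod_unfold)
  moreover have "phi_diff p = (\<lambda>a. (fst p ** snd p) ** transpose (fst a)
      + (fst p ** snd a + fst a ** snd p) ** transpose (fst p))"
    by (simp add: fun_eq_iff phi_diff_def matrix_simps)
  ultimately show ?thesis by simp
qed

lemma frechet_derivative_phi_lift: "frechet_derivative phi_lift (at p) = phi_diff p"
  by (rule frechet_derivative_at[OF has_derivative_phi_lift, symmetric])

lemma linear_phi_diff: "linear (phi_diff p)"
  using has_derivative_linear[OF has_derivative_phi_lift] .

lemma total_tangentD:
  assumes "(a, t) \<in> total_tangent (Q, D)"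
  shows "transpose Q ** a + transpose a ** Q = 0" "transpose t = t"
  using assms by (auto simp: total_tangent_def sym_mats_def)

lemma subspace_total_tangent: "subspace (total_tangent (p :: ('n::finite, 'k::finite) mat_pair))"
proof -
  let ?f = "\<lambda>a. transpose (fst p) ** a + transpose a ** fst p" and ?g = "\<lambda>t :: real^'k^'k. transpose t - t"
  have "linear ?f" "linear ?g"
    by (auto intro!: linearI simp: matrix_simps scaleR_add_right scaleR_diff_right)
  then have "subspace ({a. ?f a = 0} \<times> {t. ?g t = 0})"
    by (intro subspace_Times linear_subspace_kernel)
  then show ?thesis by (simp add: total_tangent_def sym_mats_def)
qed

lemma phi_lift_psd: "p \<in> total_space \<Longrightarrow> phi_lift (p :: ('n::finite, 'k::finite) mat_pair) \<in> spsd_rank CARD('k)"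
  by (cases p) (simp add: total_space_def phi_lift_def factorization_psd)

lemma phi_diff_sym:
  assumes "p \<in> total_space" "a \<in> total_tangent p" shows "phi_diff p a \<in> sym_mats"
proof -
  have "transpose (snd p) = snd p" "transpose (snd a) = snd a"
    using assms by (cases p, cases a, simp add: total_space_def total_tangent_def spd_matsD sym_mats_def)+
  then show ?thesis by (simp add: phi_diff_def sym_mats_def matrix_simps)
qed

text \<open>
  This lemma and the next one compute the blocks of the differential, with respect to the range of \<open>Q\<close>
  and its orthogonal complement, on which the metric depends.
\<close>

lemma phi_diff_compress:
  assumes "Q \<in> stiefel"
  shows "transpose Q ** phi_diff (Q, D) (a, t) ** Q = transpose Q ** a ** D + t + D ** transpose a ** Q"
  using assms by (simp add: phi_diff_def matrix_simps stiefel_cancel stiefelD)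

lemma phi_diff_complement:
  assumes "Q \<in> stiefel"
  shows "(mat 1 - Q ** transpose Q) ** phi_diff (Q, D) (a, t)
    = (mat 1 - Q ** transpose Q) ** a ** D ** transpose Q"
  using assms by (simp add: phi_diff_def matrix_simps stiefel_cancel)

text \<open>
  In block form with respect to the range of \<open>Q\<close>, a matrix \<open>V\<close> in \<open>bw_tangent\<close> consists of \<open>Q\<^sup>T V Q\<close>
  and \<open>P V Q\<close>, with \<open>P = 1 - Q Q\<^sup>T\<close>. They are attained by the symmetric component and by the component
  of the Stiefel tangent vector orthogonal to \<open>Q\<close>, respectively.
\<close>

lemma phi_diff_image:
  assumes p: "p \<in> total_space"
  shows "phi_diff p ` total_tangent p = bw_tangent (phi_lift p)"
proof -
  obtain Q D where QD: "p = (Q, D)" by force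
  have Q: "Q \<in> stiefel" "D \<in> spd_mats" using p by (auto simp: QD total_space_def)
  let ?P = "mat 1 - Q ** transpose Q"
  have P: "null_projector (phi_lift p) = ?P"
    by (simp add: QD phi_lift_def null_projector_factorization Q)
  have QP: "transpose Q ** ?P = 0" "?P ** Q = 0"
    using Q by (simp_all add: matrix_simps stiefel_cancel stiefelD)
  show ?thesis
  proof (intro subset_antisym subsetI)
    fix V assume "V \<in> phi_diff p ` total_tangent p"
    then obtain a where a: "a \<in> total_tangent p" "V = phi_diff p a" by blast
    have "?P ** V ** ?P = 0"
      using Q QP by (cases a) (simp add: a(2) QD phi_diff_complement, metis QP(1) matrix_mul_assoc matrix_mult.zero_right)
    then show "V \<in> bw_tangent (phi_lift p)"
      using phi_diff_sym[OF p a(1)] by (simp add: bw_tangent_def P a(2))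
  next
    fix V assume "V \<in> bw_tangent (phi_lift p)"
    then have V: "transpose V = V" "?P ** V ** ?P = 0" by (auto simp: bw_tangent_def P sym_mats_def)
    obtain E where E: "D ** E = mat 1" "E ** D = mat 1" "transpose E = E"
      using spd_invertible[OF Q(2)] by metis
    \<comment> \<open>Solving the two block equations; the first component satisfies \<open>Q\<^sup>T a = 0\<close>.\<close>
    let ?a = "(?P ** V ** Q ** E, transpose Q ** V ** Q)"
    have "transpose Q ** (?P ** V ** Q ** E) = 0" by (metis QP(1) matrix_mul_assoc matrix_mult.zero_left)
    moreover from this have "transpose (?P ** V ** Q ** E) ** Q = 0"
      by (metis matrix_transpose_mul transpose_transpose transpose_mat mat_0)
    ultimately have "?a \<in> total_tangent p"
      by (simp add: total_tangent_def QD sym_mats_def matrix_simps V)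
    moreover have "phi_diff p ?a = V"
    proof -
      have "phi_diff p ?a = ?P ** V ** Q ** transpose Q + Q ** transpose Q ** V ** Q ** transpose Q
          + Q ** transpose Q ** V ** ?P"
        by (simp add: phi_diff_def QD matrix_simps V(1) E inverse_cancel)
      also have "\<dots> = V - ?P ** V ** ?P"
        by (simp add: matrix_simps algebra_simps)
      finally show ?thesis by (simp add: V(2))
    qed
    ultimately show "V \<in> phi_diff p ` total_tangent p" by (metis imageI)
  qed
qed

text \<open>
  If the differential vanishes, then its block outside the range of \<open>Q\<close> forces \<open>a = Q A\<close> with
  \<open>A = Q\<^sup>T a\<close>, tangency makes \<open>A\<close> skew, and the remaining block determines \<open>t\<close>.
\<close>

lemma vertical_iff:
  assumes p: "p \<in> total_space"
  shows "w \<in> vertical p \<longleftrightarrow> w \<in> total_tangent p \<and> phi_diff p w = 0"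
proof -
  obtain Q D where QD: "p = (Q, D)" by force
  obtain a t where w: "w = (a, t)" by force
  have Q: "Q \<in> stiefel" "D \<in> spd_mats" "transpose D = D"
    using p by (auto simp: QD total_space_def spd_matsD)
  show ?thesis
  proof
    assume "w \<in> vertical p"
    then obtain A where A: "transpose A = - A" "a = Q ** A" "t = - (A ** D - D ** A)"
      by (auto simp: vertical_def QD w)
    show "w \<in> total_tangent p \<and> phi_diff p w = 0"
      using Q(2,3) by (simp add: w QD A total_tangent_def sym_mats_def phi_diff_def matrix_simps
          stiefel_cancel[OF Q(1)] stiefelD[OF Q(1)])
  next
    assume "w \<in> total_tangent p \<and> phi_diff p w = 0"
    then have at: "transpose Q ** a + transpose a ** Q = 0" "phi_diff (Q, D) (a, t) = 0"
      using total_tangentD(1)[of a t Q D] by (simp_all add: w QD)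
    obtain E where E: "D ** E = mat 1" using spd_invertible[OF Q(2)] by metis
    define A where "A = transpose Q ** a"
    have "(mat 1 - Q ** transpose Q) ** a ** D ** transpose Q = 0"
      using phi_diff_complement[OF Q(1), of D a t] at(2) by (simp add: matrix_mult.zero_right)
    then have "(mat 1 - Q ** transpose Q) ** a ** D ** transpose Q ** Q ** E = 0"
      by (simp add: matrix_mult.zero_left)
    then have "(mat 1 - Q ** transpose Q) ** a = 0"
      by (simp only: stiefel_cancel[OF Q(1)] inverse_cancel[OF E])
    then have a: "a = Q ** A" by (simp add: matrix_simps A_def)
    have skew: "transpose A = - A"
      using at(1) by (simp add: A_def matrix_transpose_mul add_eq_0_iff)
    have "A ** D + t + D ** transpose A = 0"
      using phi_diff_compress[OF Q(1), of D a t]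
      by (simp only: at(2) A_def matrix_transpose_mul transpose_transpose matrix_mul_assoc
          matrix_mult.zero_left matrix_mult.zero_right)
    then have "A ** D + t - D ** A = 0" by (simp add: skew matrix_mult.minus_right)
    then have "t = - (A ** D - D ** A)"
      by (simp add: algebra_simps)
    then show "w \<in> vertical p" using a skew by (auto simp: vertical_def QD w)
  qed
qed

section \<open>Points and tangent vectors of the quotient as fibres\<close>

lemma act_total_space:
  assumes "p \<in> total_space" "orthogonal_matrix G" shows "act p G \<in> total_space"
  using assms by (auto simp: act_def total_space_def stiefel_mult_orthogonal spd_conjugate)

lemma act_phi_lift:
  assumes "orthogonal_matrix G" shows "phi_lift (act p G) = phi_lift p"
  by (simp add: phi_lift_def act_def case_prod_unfold matrix_simps orthogonal_cancel[OF assms])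

lemma act_phi_diff:
  assumes "orthogonal_matrix G" shows "phi_diff (act p G) (act a G) = phi_diff p a"
  by (simp add: phi_diff_def act_def case_prod_unfold matrix_simps orthogonal_cancel[OF assms])

lemma act_total_tangent:
  assumes "a \<in> total_tangent p" shows "act a G \<in> total_tangent (act p G)"
proof -
  obtain Q D where p: "p = (Q, D)" by force
  obtain b t where a: "a = (b, t)" by force
  have "transpose G ** (transpose Q ** b + transpose b ** Q) ** G = 0"
    using total_tangentD(1)[OF assms[unfolded a p]] by (simp add: matrix_simps)
  then show ?thesis
    using total_tangentD(2)[OF assms[unfolded a p]]
    by (simp add: total_tangent_def act_def p a sym_mats_def matrix_simps)
qed

lemma act_inverse:
  assumes "orthogonal_matrix G" shows "act (act a (transpose G)) G = a"
  by (simp add: act_def case_prod_unfold matrix_simps orthogonal_cancel[OF assms] orthogonal_matrixD[OF assms])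

lemma orbit_iff_phi_lift_eq:
  assumes "p \<in> total_space" "q \<in> total_space"
  shows "(\<exists>G. orthogonal_matrix G \<and> q = act p G) \<longleftrightarrow> phi_lift p = phi_lift q"
proof
  assume "phi_lift p = phi_lift q"
  moreover obtain Q D Q' D' where "p = (Q, D)" "q = (Q', D')" by (metis surj_pair)
  ultimately show "\<exists>G. orthogonal_matrix G \<and> q = act p G"
    using factorization_unique[of Q Q' D D'] assms by (auto simp: total_space_def phi_lift_def act_def)
qed (auto simp: act_phi_lift)

text \<open>
  The quotient is the set of fibres of the parametrisation. This makes the induced map injective and
  lets representatives be compared through their images instead of through group elements.
\<close>

lemma orbit_rel_iff: "(p, q) \<in> orbit_rel \<longleftrightarrow> p \<in> total_space \<and> q \<in> total_space \<and> phi_lift p = phi_lift q"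
  unfolding orbit_rel_def using orbit_iff_phi_lift_eq[of p q] act_total_space by blast

text \<open>
  The analogue for tangent vectors: moving along the orbit does not change the differential, and at a
  fixed point its kernel is the vertical space. Classes of tangent vectors are therefore the fibres
  of the differential.
\<close>

lemma tangent_rel_iff:
  "((p, a), (q, b)) \<in> tangent_rel \<longleftrightarrow>
     p \<in> total_space \<and> q \<in> total_space \<and> a \<in> total_tangent p \<and> b \<in> total_tangent q \<and>
     phi_lift p = phi_lift q \<and> phi_diff p a = phi_diff q b"
proof
  assume "((p, a), (q, b)) \<in> tangent_rel"
  then obtain G w where *: "p \<in> total_space" "a \<in> total_tangent p" "orthogonal_matrix G"
      "w \<in> vertical p" "q = act p G" "b = act (a + w) G"
    by (auto simp: tangent_rel_def)
  have w: "w \<in> total_tangent p" "phi_diff p w = 0" using *(4) vertical_iff[OF *(1)] by auto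
  have "phi_diff p (a + w) = phi_diff p a" by (simp add: linear_add[OF linear_phi_diff] w)
  then show "p \<in> total_space \<and> q \<in> total_space \<and> a \<in> total_tangent p \<and> b \<in> total_tangent q \<and>
     phi_lift p = phi_lift q \<and> phi_diff p a = phi_diff q b"
    using * w by (auto simp: act_total_space act_phi_lift act_phi_diff
        intro!: act_total_tangent subspace_add[OF subspace_total_tangent])
next
  assume *: "p \<in> total_space \<and> q \<in> total_space \<and> a \<in> total_tangent p \<and> b \<in> total_tangent q \<and>
     phi_lift p = phi_lift q \<and> phi_diff p a = phi_diff q b"
  then obtain G where G: "orthogonal_matrix G" "q = act p G"
    using orbit_iff_phi_lift_eq by blast
  have G': "orthogonal_matrix (transpose G)" using G(1) by (simp add: orthogonal_matrix_def)
  have p: "act q (transpose G) = p" using act_inverse[OF G', of p] G(2) by simp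
  \<comment> \<open>Transport b back to p; there it differs from a by a vertical vector.\<close>
  define c where "c = act b (transpose G)"
  have c: "c \<in> total_tangent p" "phi_diff p c = phi_diff p a"
    using * act_total_tangent[of b q "transpose G"] act_phi_diff[OF G', of q b]
    by (auto simp: c_def p)
  have "c - a \<in> vertical p"
    using * c by (simp add: vertical_iff linear_diff[OF linear_phi_diff] subspace_diff[OF subspace_total_tangent])
  moreover have "b = act (a + (c - a)) G" by (simp add: c_def act_inverse[OF G(1)])
  ultimately show "((p, a), (q, b)) \<in> tangent_rel"
    using * G unfolding tangent_rel_def by blast
qed

lemma cls_eq:
  "p \<in> total_space \<Longrightarrow> cls p = {q \<in> total_space. phi_lift q = phi_lift p}"
  by (auto simp: cls_def orbit_rel_iff)

lemma tcls_eq: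
  assumes "p \<in> total_space" "a \<in> total_tangent p"
  shows "tcls p a = {(q, b). q \<in> total_space \<and> b \<in> total_tangent q \<and>
    phi_lift q = phi_lift p \<and> phi_diff q b = phi_diff p a}"
  using assms by (auto simp: tcls_def tangent_rel_iff)

lemma quot_eq: "quot = cls ` total_space"
  by (auto simp: quot_def quotient_def cls_def)

lemma phi_cls:
  assumes "p \<in> total_space" shows "phi (cls p) = phi_lift p"
proof -
  have "phi_lift ` cls p = {phi_lift p}" using assms by (auto simp: cls_eq)
  then show ?thesis by (simp add: quot_map_def)
qed

lemma dphi_eqI:
  assumes "u \<noteq> {}" "\<And>p a. (p, a) \<in> u \<Longrightarrow> phi_diff p a = V" shows "dphi u = V"
proof -
  have "(\<lambda>(p, a). phi_diff p a) z = V" if "z \<in> u" for z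
    using that assms(2) by (cases z) simp
  then have "(\<lambda>(p, a). phi_diff p a) ` u = {V}" using assms(1) by (simp add: image_constant_conv cong: image_cong_simp)
  then show ?thesis by (simp add: quot_diff_def frechet_derivative_phi_lift)
qed

lemma mem_tcls: "p \<in> total_space \<Longrightarrow> a \<in> total_tangent p \<Longrightarrow> (p, a) \<in> tcls p a"
  by (simp add: tcls_eq)

lemma dphi_tcls:
  assumes "p \<in> total_space" "a \<in> total_tangent p" shows "dphi (tcls p a) = phi_diff p a"
proof (rule dphi_eqI)
  show "tcls p a \<noteq> {}" using mem_tcls[OF assms] by blast
qed (simp add: tcls_eq[OF assms])

lemma quot_tangent_cls:
  assumes p: "p \<in> total_space"
  shows "quot_tangent (cls p) = tcls p ` total_tangent p"
proof (intro subset_antisym subsetI)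
  fix u assume "u \<in> quot_tangent (cls p)"
  then obtain q b where q: "q \<in> total_space" "phi_lift q = phi_lift p" "b \<in> total_tangent q" "u = tcls q b"
    using p by (auto simp: quot_tangent_def cls_eq)
  then obtain a where "a \<in> total_tangent p" "phi_diff p a = phi_diff q b"
    using phi_diff_image[OF p] phi_diff_image[OF q(1)] by (metis imageE imageI)
  then have "u = tcls p a" "a \<in> total_tangent p" using p q by (simp_all add: tcls_eq)
  then show "u \<in> tcls p ` total_tangent p" by simp
next
  fix u assume "u \<in> tcls p ` total_tangent p"
  moreover have "p \<in> cls p" using p by (simp add: cls_eq)
  ultimately show "u \<in> quot_tangent (cls p)" unfolding quot_tangent_def by blast
qed

lemma tzero_cls:
  assumes p: "(p :: ('n::finite, 'k::finite) mat_pair) \<in> total_space"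
  shows "tzero (cls p) = tcls p 0"
proof -
  have 0: "0 \<in> total_tangent q" "phi_diff q 0 = 0" for q :: "('n, 'k) mat_pair"
    by (simp_all add: subspace_0[OF subspace_total_tangent] linear_0[OF linear_phi_diff])
  have "(q, b) \<in> tzero (cls p) \<longleftrightarrow> (q, b) \<in> tcls p 0" for q b
  proof -
    have "(q, b) \<in> tzero (cls p) \<longleftrightarrow> (\<exists>r\<in>cls p. ((r, 0), (q, b)) \<in> tangent_rel)"
      by (auto simp: tzero_def)
    also have "\<dots> \<longleftrightarrow> (q, b) \<in> tcls p 0"
      unfolding cls_eq[OF p] tcls_eq[OF p 0(1)] tangent_rel_iff
      using p by (auto simp: 0 simp del: split_paired_Ex)
    finally show ?thesis .
  qed
  then show ?thesis by auto
qed

lemma dphi_tadd: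
  assumes p: "p \<in> total_space" and a: "a \<in> total_tangent p" and b: "b \<in> total_tangent p"
  shows "dphi (tadd (tcls p a) (tcls p b)) = phi_diff p a + phi_diff p b"
proof (rule dphi_eqI)
  have "((p, a + b), (p, a + b)) \<in> tangent_rel"
    using assms by (simp add: tangent_rel_iff subspace_add[OF subspace_total_tangent])
  then show "tadd (tcls p a) (tcls p b) \<noteq> {}"
    using mem_tcls[OF p a] mem_tcls[OF p b] unfolding tadd_def by blast
  fix q c assume "(q, c) \<in> tadd (tcls p a) (tcls p b)"
  then obtain r a' b' where "(r, a') \<in> tcls p a" "(r, b') \<in> tcls p b" "((r, a' + b'), (q, c)) \<in> tangent_rel"
    by (auto simp: tadd_def)
  then show "phi_diff q c = phi_diff p a + phi_diff p b"
    using assms by (simp add: tcls_eq tangent_rel_iff linear_add[OF linear_phi_diff])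
qed

lemma dphi_tscale:
  assumes p: "p \<in> total_space" and a: "a \<in> total_tangent p"
  shows "dphi (tscale c (tcls p a)) = c *\<^sub>R phi_diff p a"
proof (rule dphi_eqI)
  have "((p, c *\<^sub>R a), (p, c *\<^sub>R a)) \<in> tangent_rel"
    using assms by (simp add: tangent_rel_iff subspace_scale[OF subspace_total_tangent])
  then show "tscale c (tcls p a) \<noteq> {}"
    using mem_tcls[OF p a] unfolding tscale_def by blast
  fix q b assume "(q, b) \<in> tscale c (tcls p a)"
  then obtain r a' where "(r, a') \<in> tcls p a" "((r, c *\<^sub>R a'), (q, b)) \<in> tangent_rel"
    by (auto simp: tscale_def)
  then show "phi_diff q b = c *\<^sub>R phi_diff p a"
    using assms by (simp add: tcls_eq tangent_rel_iff linear_scale[OF linear_phi_diff])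
qed

lemma pullback_metric_tcls:
  fixes p :: "('n::finite, 'k::finite) mat_pair"
  assumes "p \<in> total_space" "a \<in> total_tangent p" "b \<in> total_tangent p"
  shows "pullback_metric (cls p) (tcls p a) (tcls p b)
    = bw_metric TYPE('k) (phi_lift p) (phi_diff p a) (phi_diff p b)"
  using assms by (simp add: pullback_metric_def phi_cls dphi_tcls)

section \<open>The metric on the total space\<close>

text \<open>
  The pullback metric as a function of representatives. Neither the inverse of \<open>D\<close> nor a generalised
  inverse occurs, so the expression is smooth wherever the Sylvester equation is uniquely solvable.
\<close>

definition lifted_metric ::
  "('n::finite, 'k::finite) mat_pair \<Rightarrow> ('n, 'k) mat_pair \<Rightarrow> ('n, 'k) mat_pair \<Rightarrow> real" where
  "lifted_metric p a b =
     (let Q = fst p; D = snd p;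
          S = \<lambda>v. sylvester D (transpose Q ** fst v ** D + snd v + D ** transpose (fst v) ** Q)
      in trace (S a ** D ** S b) + trace ((mat 1 - Q ** transpose Q) ** fst a ** D ** transpose (fst b)))"

text \<open>
  Let \<open>P = 1 - Q Q\<^sup>T\<close>. In the second term of the Bures--Wasserstein metric, \<open>P V Q\<close> equals
  \<open>P a D\<close>, so the \<open>D\<close> cancels the inverse of \<open>D\<close> from the Moore--Penrose inverse. Since \<open>P\<close> is idempotent, the cyclic property of the
  trace puts a second \<open>P\<close> next to the other vector, where it leaves only \<open>D b\<^sup>T P\<close>.
\<close>

lemma bw_metric_phi_diff:
  fixes p :: "('n::finite, 'k::finite) mat_pair"
  assumes "p \<in> total_space"
  shows "bw_metric TYPE('k) (phi_lift p) (phi_diff p a) (phi_diff p b) = lifted_metric p a b"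
proof -
  obtain Q D where p: "p = (Q, D)" by force
  obtain x t where a: "a = (x, t)" by force
  obtain y s where b: "b = (y, s)" by force
  have Q: "Q \<in> stiefel" "D \<in> spd_mats" using assms by (auto simp: p total_space_def)
  obtain E where E: "D ** E = mat 1" "E ** D = mat 1" "transpose E = E"
    using spd_invertible[OF Q(2)] by metis
  let ?P = "mat 1 - Q ** transpose Q"
  have P: "transpose ?P = ?P" "?P ** ?P = ?P"
    using Q by (simp_all add: matrix_simps stiefel_cancel)
  have PV: "?P ** phi_diff p a ** Q ** E = ?P ** x"
    unfolding p a phi_diff_complement[OF Q(1)] by (simp only: stiefel_cancel[OF Q(1)] inverse_cancel[OF E(1)])
  have WP: "transpose Q ** phi_diff p b ** ?P = D ** transpose y ** ?P"
    using Q by (simp add: p b phi_diff_def matrix_simps stiefel_cancel stiefelD)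
  have "trace (?P ** phi_diff p a ** Q ** E ** transpose Q ** phi_diff p b)
      = trace (?P ** (?P ** x ** (transpose Q ** phi_diff p b)))"
    by (simp only: PV P(2) matrix_mul_assoc)
  also have "\<dots> = trace (?P ** x ** (transpose Q ** phi_diff p b ** ?P))"
    by (subst trace_mul_sym) (simp only: matrix_mul_assoc)
  also have "\<dots> = trace ((?P ** x ** D ** transpose y) ** ?P)" by (simp only: WP matrix_mul_assoc)
  also have "\<dots> = trace (?P ** x ** D ** transpose y)"
    by (subst trace_mul_sym) (simp only: matrix_mul_assoc P(2))
  finally have 2: "trace (?P ** phi_diff p a ** Q ** E ** transpose Q ** phi_diff p b)
      = trace (?P ** x ** D ** transpose y)" .
  show ?thesis
    using 2 unfolding p phi_lift_def case_prod_conv bw_metric_factorization[OF Q E]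
    by (simp add: a b phi_diff_compress[OF Q(1)] lifted_metric_def Let_def)
qed

text \<open>
  Both terms are squared norms weighted by \<open>D\<close>, of the Sylvester solution \<open>S\<close> and of \<open>P a\<close>, the part of
  \<open>a\<close> orthogonal to the columns of \<open>Q\<close>. If both vanish, then \<open>S = 0\<close> kills
  the block inside the range of \<open>Q\<close> and \<open>P a = 0\<close> the other one, so
  the differential vanishes.
\<close>

lemma lifted_metric_pos:
  fixes p :: "('n::finite, 'k::finite) mat_pair"
  assumes p: "p \<in> total_space" and a: "a \<in> total_tangent p" and nz: "phi_diff p a \<noteq> 0"
  shows "lifted_metric p a a > 0"
proof -
  obtain Q D where QD: "p = (Q, D)" by force
  obtain x t where xt: "a = (x, t)" by force
  have Q: "Q \<in> stiefel" "D \<in> spd_mats" "transpose D = D"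
    using p by (auto simp: QD total_space_def spd_matsD)
  have t: "transpose t = t" using total_tangentD a by (auto simp: QD xt)
  let ?P = "mat 1 - Q ** transpose Q"
  define X where "X = transpose Q ** x ** D + t + D ** transpose x ** Q"
  define S where "S = sylvester D X"
  obtain c where c: "c > 0" "\<And>C :: real^'k^'k. c * (norm C)\<^sup>2 \<le> C \<bullet> (C ** D)"
    using spd_coercive[OF Q(2)] by blast
  obtain d where d: "d > 0" "\<And>C :: real^'k^'n. d * (norm C)\<^sup>2 \<le> C \<bullet> (C ** D)"
    using spd_coercive[OF Q(2)] by blast
  have "transpose X = X"
    by (simp add: X_def matrix_simps Q t algebra_simps)
  then have S: "transpose S = S" by (simp add: S_def transpose_sylvester Q)
  have 1: "trace (S ** D ** S) = S \<bullet> (S ** D)"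
    unfolding inner_matrix_trace S by (subst trace_mul_sym) (simp only: matrix_mul_assoc)
  have P: "transpose ?P = ?P" "?P ** ?P = ?P"
    using Q(1) by (simp_all add: matrix_simps stiefel_cancel)
  have "trace (?P ** x ** D ** transpose x) = trace (?P ** (?P ** x ** D ** transpose x))"
    by (simp only: matrix_mul_assoc P)
  also have "\<dots> = trace ((?P ** x ** D) ** (transpose x ** ?P))"
    by (subst trace_mul_sym) (simp only: matrix_mul_assoc)
  also have "\<dots> = trace (transpose (?P ** x) ** (?P ** x ** D))"
    by (subst trace_mul_sym) (simp only: matrix_transpose_mul P)
  finally have 2: "trace (?P ** x ** D ** transpose x) = (?P ** x) \<bullet> (?P ** x ** D)"
    by (simp only: inner_matrix_trace)
  have eq: "lifted_metric p a a = S \<bullet> (S ** D) + (?P ** x) \<bullet> (?P ** x ** D)"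
    by (simp add: lifted_metric_def QD xt S_def[symmetric] X_def[symmetric] 1 2)
  have "S \<noteq> 0 \<or> ?P ** x \<noteq> 0"
  proof (rule ccontr)
    assume "\<not> ?thesis"
    then have 0: "S = 0" "?P ** x = 0" by auto
    have "X = 0" using sylvester_solves[OF Q(2), of X] 0(1) by (simp add: S_def)
    have x: "x = Q ** transpose Q ** x" using 0(2) by (simp add: matrix_simps)
    have x': "transpose x = transpose x ** Q ** transpose Q" by (subst x) (simp add: matrix_simps)
    have "phi_diff p a = Q ** transpose Q ** x ** D ** transpose Q + Q ** t ** transpose Q
        + Q ** D ** (transpose x ** Q ** transpose Q)"
      using x x' by (simp add: phi_diff_def QD xt)
    also have "\<dots> = Q ** X ** transpose Q" by (simp add: X_def matrix_simps)
    finally show False using nz \<open>X = 0\<close> by simp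
  qed
  moreover have "S \<bullet> (S ** D) \<ge> c * (norm S)\<^sup>2" "(?P ** x) \<bullet> (?P ** x ** D) \<ge> d * (norm (?P ** x))\<^sup>2"
    using c(2) d(2) by blast+
  moreover have "c * (norm S)\<^sup>2 + d * (norm (?P ** x))\<^sup>2 > 0" if "S \<noteq> 0 \<or> ?P ** x \<noteq> 0"
    using that c(1) d(1) by (auto intro: add_pos_nonneg add_nonneg_pos)
  ultimately show ?thesis using eq by linarith
qed

section \<open>Smoothness of the metric\<close>

text \<open>
  A linear projection onto the symmetric matrices. Composing with it extends functions of a symmetric
  positive definite argument to an open set of matrices.
\<close>

definition sym_part :: "real^'k^'k \<Rightarrow> real^'k^'k" where
  "sym_part D = (1/2) *\<^sub>R (D + transpose D)"

lemma sym_part_spd: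
  assumes "\<And>x. x \<noteq> 0 \<Longrightarrow> x \<bullet> (D *v x) > 0" shows "sym_part D \<in> spd_mats"
proof -
  have "x \<bullet> (transpose D *v x) = x \<bullet> (D *v x)" for x
    by (metis dot_lmul_matrix inner_commute vector_transpose_matrix transpose_transpose)
  then have "x \<bullet> (sym_part D *v x) = x \<bullet> (D *v x)" for x
    by (simp add: sym_part_def scaleR_matrix_vector_assoc[symmetric] matrix_vector_mult_add_rdistrib
        inner_add_right del: transpose_matrix_vector)
  then show ?thesis
    using assms by (simp add: spd_mats_def sym_mats_def sym_part_def matrix_simps add.commute)
qed

lemma sym_part_eq: "D \<in> spd_mats \<Longrightarrow> sym_part D = D"
  by (simp add: sym_part_def spd_matsD scaleR_2[symmetric])

lemma bounded_linear_sym_part: "bounded_linear sym_part"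
  by (simp add: linear_conv_bounded_linear[symmetric] linear_iff sym_part_def matrix_simps algebra_simps)

lemma lifted_metric_Cr_on:
  fixes U :: "(('n::finite, 'k::finite) mat_pair \<times> ('n, 'k) mat_pair \<times> ('n, 'k) mat_pair) set"
  assumes U: "open U" and spd: "\<And>z. z \<in> U \<Longrightarrow> sym_part (snd (fst z)) \<in> spd_mats"
  shows "Cr_on r U (\<lambda>z. lifted_metric (fst (fst z), sym_part (snd (fst z))) (fst (snd z)) (snd (snd z)))"
proof -
  have Q: "Cr_on r U (\<lambda>z. fst (fst z))" and D0: "Cr_on r U (\<lambda>z. snd (fst z))"
    and a: "Cr_on r U (\<lambda>z. fst (fst (snd z)))" "Cr_on r U (\<lambda>z. snd (fst (snd z)))"
    and b: "Cr_on r U (\<lambda>z. fst (snd (snd z)))" "Cr_on r U (\<lambda>z. snd (snd (snd z)))"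
    by (intro Cr_on_linear[OF U] bounded_linear_fst_comp bounded_linear_snd_comp bounded_linear_ident)+
  have D: "Cr_on r U (\<lambda>z. sym_part (snd (fst z)))"
    by (rule Cr_on_linear_compose[OF U bounded_linear_sym_part D0])
  note mult = Cr_on_bilinear[OF U bounded_bilinear_matrix_mult]
    and tr = Cr_on_linear_compose[OF U bounded_linear_transpose]
    and add = Cr_on_add[OF U]
  have S: "Cr_on r U (\<lambda>z. sylvester (sym_part (snd (fst z)))
       (transpose (fst (fst z)) ** f z ** sym_part (snd (fst z)) + g z +
        sym_part (snd (fst z)) ** transpose (f z) ** fst (fst z)))"
    if "Cr_on r U f" "Cr_on r U g" for f g
    by (intro Cr_on_sylvester[OF U spd D] add mult tr Q D that)
  show ?thesis
    unfolding lifted_metric_def Let_def fst_conv snd_conv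
    by (intro add Cr_on_linear_compose[OF U bounded_linear_trace] mult S tr Cr_on_diff[OF U]
        Cr_on_const[OF U] a b Q D)
qed

lemma smooth_on_pullback_metric:
  "smooth_on {(p, a, b). p \<in> (total_space :: ('n::finite, 'k::finite) mat_pair set)
      \<and> a \<in> total_tangent p \<and> b \<in> total_tangent p}
     (\<lambda>(p, a, b). pullback_metric (cls p) (tcls p a) (tcls p b))"
proof -
  let ?T = "{(p, a, b). p \<in> (total_space :: ('n, 'k) mat_pair set) \<and> a \<in> total_tangent p \<and> b \<in> total_tangent p}"
  let ?U = "{z :: ('n, 'k) mat_pair \<times> ('n, 'k) mat_pair \<times> ('n, 'k) mat_pair.
    snd (fst z) \<in> {D. \<forall>x. x \<noteq> 0 \<longrightarrow> x \<bullet> (D *v x) > 0}}"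
  let ?g = "\<lambda>z :: ('n, 'k) mat_pair \<times> ('n, 'k) mat_pair \<times> ('n, 'k) mat_pair.
    lifted_metric (fst (fst z), sym_part (snd (fst z))) (fst (snd z)) (snd (snd z))"
  have U: "open ?U"
    using open_vimage[OF open_pos_form, of "\<lambda>z :: ('n, 'k) mat_pair \<times> ('n, 'k) mat_pair \<times> ('n, 'k) mat_pair. snd (fst z)"]
    by (simp add: vimage_def continuous_on_fst continuous_on_snd)
  have "Cr_on r ?U ?g" for r
    by (rule lifted_metric_Cr_on[OF U]) (auto intro: sym_part_spd)
  moreover have "z \<in> ?U \<and> ?g z = (case z of (p, a, b) \<Rightarrow> pullback_metric (cls p) (tcls p a) (tcls p b))"
    if "z \<in> ?T" for z
  proof -
    obtain p a b where z: "z = (p, a, b)" by (metis surj_pair)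
    have *: "p \<in> total_space" "a \<in> total_tangent p" "b \<in> total_tangent p" using that z by auto
    then have "snd p \<in> spd_mats" by (auto simp: total_space_def)
    then show ?thesis
      using * by (simp add: z pullback_metric_tcls bw_metric_phi_diff sym_part_eq spd_matsD)
  qed
  ultimately show ?thesis
    unfolding smooth_on_def using U by (intro ballI exI[of _ ?U] exI[of _ ?g]) auto
qed

lemma pullback_riemannian_metric:
  "riemannian_metric_on_quot (pullback_metric :: ('n::finite, 'k::finite) mat_pair set \<Rightarrow> _)"
proof -
  let ?h = "pullback_metric :: ('n, 'k) mat_pair set \<Rightarrow> _"
  have "(\<forall>u\<in>quot_tangent x. \<forall>v\<in>quot_tangent x. ?h x u v = ?h x v u) \<and>
        (\<forall>u\<in>quot_tangent x. \<forall>v\<in>quot_tangent x. \<forall>w\<in>quot_tangent x.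
           ?h x (tadd u v) w = ?h x u w + ?h x v w) \<and>
        (\<forall>c. \<forall>u\<in>quot_tangent x. \<forall>v\<in>quot_tangent x. ?h x (tscale c u) v = c * ?h x u v) \<and>
        (\<forall>u\<in>quot_tangent x. u \<noteq> tzero x \<longrightarrow> ?h x u u > 0)"
    if x: "x \<in> quot" for x
  proof -
    obtain p where p: "p \<in> total_space" "x = cls p" using x by (auto simp: quot_eq)
    note psd = phi_lift_psd[OF p(1)]
    have "?h x u v = ?h x v u" if "u \<in> quot_tangent x" "v \<in> quot_tangent x" for u v
      using that p by (auto simp: quot_tangent_cls pullback_metric_tcls intro!: bw_metric_sym psd phi_diff_sym)
    moreover have "?h x (tadd u v) w = ?h x u w + ?h x v w"
      if "u \<in> quot_tangent x" "v \<in> quot_tangent x" for u v w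
      using that p by (auto simp: quot_tangent_cls pullback_metric_def dphi_tadd dphi_tcls phi_cls bw_metric_add_left psd)
    moreover have "?h x (tscale c u) v = c * ?h x u v" if "u \<in> quot_tangent x" for c u v
      using that p by (auto simp: quot_tangent_cls pullback_metric_def dphi_tscale dphi_tcls phi_cls bw_metric_scale_left psd)
    moreover have "?h x u u > 0" if u: "u \<in> quot_tangent x" "u \<noteq> tzero x" for u
    proof -
      obtain a where a: "a \<in> total_tangent p" "u = tcls p a" using u(1) p by (auto simp: quot_tangent_cls)
      have "phi_diff p a \<noteq> 0"
      proof
        assume "phi_diff p a = 0"
        then have "tcls p a = tcls p 0"
          using a(1) p(1) by (simp add: tcls_eq subspace_0[OF subspace_total_tangent] linear_0[OF linear_phi_diff])
        then show False using u(2) a(2) by (simp add: p tzero_cls)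
      qed
      then show ?thesis
        using a p lifted_metric_pos[OF p(1) a(1)] by (simp add: pullback_metric_tcls bw_metric_phi_diff)
    qed
    ultimately show ?thesis by blast
  qed
  then show ?thesis
    unfolding riemannian_metric_on_quot_def by (intro conjI[OF ballI smooth_on_pullback_metric])
qed

section \<open>The diffeomorphism and its local lifts\<close>

lemma bij_phi:
  "bij_betw phi (quot :: ('n::finite, 'k::finite) mat_pair set set) (spsd_rank CARD('k))"
  unfolding bij_betw_def
proof
  show "inj_on phi (quot :: ('n, 'k) mat_pair set set)"
  proof (rule inj_onI)
    fix x y assume "x \<in> (quot :: ('n, 'k) mat_pair set set)" "y \<in> (quot :: ('n, 'k) mat_pair set set)"
      "phi x = phi y"
    then obtain p q where pq: "p \<in> total_space" "x = cls p" "q \<in> total_space" "y = cls q"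
      unfolding quot_eq by blast
    with \<open>phi x = phi y\<close> have "phi_lift p = phi_lift q" by (simp add: phi_cls)
    with pq show "x = y" by (simp add: cls_eq)
  qed
  show "phi ` (quot :: ('n, 'k) mat_pair set set) = spsd_rank CARD('k)"
  proof (intro subset_antisym subsetI)
    fix A :: "real^'n^'n" assume "A \<in> spsd_rank CARD('k)"
    then obtain Q :: "real^'k^'n" and D where Q: "Q \<in> stiefel" "D \<in> spd_mats" "A = Q ** D ** transpose Q"
      by (rule psd_factorization)
    then have "(Q, D) \<in> total_space" "phi_lift (Q, D) = A" by (simp_all add: total_space_def phi_lift_def)
    then have "cls (Q, D) \<in> quot" "phi (cls (Q, D)) = A" by (simp_all add: quot_eq phi_cls)
    then show "A \<in> phi ` (quot :: ('n, 'k) mat_pair set set)" by blast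
  next
    fix A assume "A \<in> phi ` (quot :: ('n, 'k) mat_pair set set)"
    then obtain p :: "('n, 'k) mat_pair" where "p \<in> total_space" "A = phi (cls p)"
      unfolding quot_eq by blast
    then show "A \<in> spsd_rank CARD('k)" by (simp add: phi_cls phi_lift_psd)
  qed
qed

lemma smooth_phi: "smooth_from_quot (phi :: ('n::finite, 'k::finite) mat_pair set \<Rightarrow> real^'n^'n)"
proof -
  have "Cr_on r UNIV (phi_lift :: ('n, 'k) mat_pair \<Rightarrow> _)" for r
    unfolding phi_lift_def case_prod_unfold
    by (intro Cr_on_bilinear[OF open_UNIV bounded_bilinear_matrix_mult]
        Cr_on_linear_compose[OF open_UNIV bounded_linear_transpose] Cr_on_linear[OF open_UNIV]
        bounded_linear_fst bounded_linear_snd)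
  then show ?thesis
    unfolding smooth_from_quot_def smooth_on_def
    by (intro ballI exI[of _ UNIV] exI[of _ phi_lift]) (auto simp: phi_cls)
qed

lemma spd_mult_inj:
  assumes "R \<in> spd_mats" shows "inj (\<lambda>X :: real^'k^'n. X ** R)"
proof -
  obtain E where E: "R ** E = mat 1" using spd_invertible[OF assms] by metis
  show ?thesis
  proof (rule injI)
    fix X Y :: "real^'k^'n" assume "X ** R = Y ** R"
    then have "X ** R ** E = Y ** R ** E" by simp
    then show "X = Y" by (simp only: inverse_cancel[OF E])
  qed
qed

lemma gram_matrix_spd:
  fixes A :: "real^'k^'n"
  assumes "\<forall>x. x \<noteq> 0 \<longrightarrow> x \<bullet> ((transpose A ** A) *v x) > 0"
  shows "transpose A ** A \<in> spd_mats"
  using assms by (simp add: spd_mats_def sym_mats_def matrix_simps)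

text \<open>
  Near \<open>A\<^sub>0 = Q\<^sub>0 D\<^sub>0 Q\<^sub>0\<^sup>T\<close> the columns of \<open>A Q\<^sub>0\<close> stay independent and, if \<open>A\<close> has rank \<open>k\<close>, span its
  range. Orthonormalising them by the polar decomposition, that is dividing by the square root of the
  Gram matrix, depends smoothly on \<open>A\<close>, and the result is the \<open>Q\<close> of a factorisation.
\<close>

lemma local_lift:
  fixes A\<^sub>0 :: "real^'n^'n"
  assumes "A\<^sub>0 \<in> spsd_rank CARD('k::finite)"
  obtains U and \<sigma> :: "real^'n^'n \<Rightarrow> ('n::finite, 'k::finite) mat_pair"
  where "open U" "A\<^sub>0 \<in> U" "\<And>r. Cr_on r U \<sigma>"
    "\<And>A. A \<in> U \<Longrightarrow> A \<in> spsd_rank CARD('k::finite) \<Longrightarrow> \<sigma> A \<in> total_space \<and> phi_lift (\<sigma> A) = A"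
proof -
  obtain Q\<^sub>0 :: "real^'k^'n" and D\<^sub>0 where Q0: "Q\<^sub>0 \<in> stiefel" "D\<^sub>0 \<in> spd_mats" "A\<^sub>0 = Q\<^sub>0 ** D\<^sub>0 ** transpose Q\<^sub>0"
    using psd_factorization[OF assms] by blast
  define gram where "gram = (\<lambda>A :: real^'n^'n. transpose (A ** Q\<^sub>0) ** (A ** Q\<^sub>0))"
  define R where "R = (\<lambda>A. msqrt (gram A))"
  define Q where "Q = (\<lambda>A. inv (\<lambda>X :: real^'k^'n. X ** R A) (A ** Q\<^sub>0))"
  define \<sigma> where "\<sigma> = (\<lambda>A. (Q A, transpose (Q A) ** A ** Q A))"
  define U where "U = gram -` {M. \<forall>x. x \<noteq> 0 \<longrightarrow> x \<bullet> (M *v x) > 0}"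
  have gram_spd: "gram A \<in> spd_mats" if "A \<in> U" for A
    using that unfolding U_def gram_def by (auto intro!: gram_matrix_spd)
  have R: "R A \<in> spd_mats" "R A ** R A = gram A" if "A \<in> U" for A
    using msqrt[OF gram_spd[OF that]] by (simp_all add: R_def)
  have QR: "Q A ** R A = A ** Q\<^sub>0" if "A \<in> U" for A
  proof -
    have "linear (\<lambda>X :: real^'k^'n. X ** R A)"
      using matrix_mult.bounded_linear_left by (rule bounded_linear.linear)
    from inj_linear_solve[OF this spd_mult_inj[OF R(1)[OF that]]] show ?thesis by (simp add: Q_def)
  qed
  have lin: "Cr_on r S (\<lambda>A. A ** Q\<^sub>0)" if "open S" for S r
    by (rule Cr_on_linear[OF that matrix_mult.bounded_linear_left])
  have gram: "Cr_on r S gram" if "open S" for S r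
    unfolding gram_def
    by (intro Cr_on_bilinear[OF that bounded_bilinear_matrix_mult]
        Cr_on_linear_compose[OF that bounded_linear_transpose] lin that)
  have U: "open U"
    unfolding U_def using gram[of UNIV 0] by (intro open_vimage open_pos_form) simp
  have "A\<^sub>0 ** Q\<^sub>0 = Q\<^sub>0 ** D\<^sub>0" using Q0 by (simp add: stiefel_cancel)
  then have "gram A\<^sub>0 = D\<^sub>0 ** D\<^sub>0"
    using Q0 by (simp add: gram_def matrix_simps stiefel_cancel stiefelD spd_matsD)
  have "A\<^sub>0 \<in> U"
  proof -
    have "x \<bullet> ((D\<^sub>0 ** D\<^sub>0) *v x) > 0" if "x \<noteq> 0" for x
    proof -
      have "D\<^sub>0 *v x \<noteq> 0" using spd_matsD(2)[OF Q0(2) that] by auto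
      moreover have "x \<bullet> ((D\<^sub>0 ** D\<^sub>0) *v x) = (D\<^sub>0 *v x) \<bullet> (D\<^sub>0 *v x)"
        by (simp add: matrix_vector_mul_assoc[symmetric] sym_inner[OF spd_matsD(1)[OF Q0(2)]])
      ultimately show ?thesis by simp
    qed
    then show ?thesis by (simp add: U_def \<open>gram A\<^sub>0 = D\<^sub>0 ** D\<^sub>0\<close>)
  qed
  moreover have "Cr_on r U \<sigma>" for r
  proof -
    have bil: "bounded_bilinear (\<lambda>R X :: real^'k^'n. X ** (R :: real^'k^'k))"
      by (rule bounded_bilinear.flip[OF bounded_bilinear_matrix_mult])
    have "Cr_on r U R" unfolding R_def by (rule Cr_on_msqrt[OF U gram_spd gram[OF U]])
    then have Q: "Cr_on r U Q"
      unfolding Q_def by (intro Cr_on_linear_solve[OF U bil] spd_mult_inj R lin U)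
    have "Cr_on r U (\<lambda>A. A)" by (rule Cr_on_linear[OF U bounded_linear_ident])
    then show ?thesis
      unfolding \<sigma>_def
      by (intro Cr_on_Pair[OF U] Cr_on_bilinear[OF U bounded_bilinear_matrix_mult]
          Cr_on_linear_compose[OF U bounded_linear_transpose] Q)
  qed
  moreover have "\<sigma> A \<in> total_space \<and> phi_lift (\<sigma> A) = A"
    if A: "A \<in> U" "A \<in> spsd_rank CARD('k)" for A
  proof -
    obtain Q\<^sub>1 :: "real^'k^'n" and D\<^sub>1 where Q1: "Q\<^sub>1 \<in> stiefel" "D\<^sub>1 \<in> spd_mats" "A = Q\<^sub>1 ** D\<^sub>1 ** transpose Q\<^sub>1"
      using psd_factorization[OF A(2)] by blast
    obtain E where E: "R A ** E = mat 1" "E ** R A = mat 1" "transpose E = E"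
      using spd_invertible[OF R(1)[OF A(1)]] by metis
    have QA: "Q A = A ** Q\<^sub>0 ** E" using QR[OF A(1)] inverse_cancel[OF E(1)] by metis
    have "transpose (Q A) ** Q A = E ** gram A ** E"
      by (simp add: QA gram_def matrix_simps E(3))
    also have "\<dots> = mat 1" by (simp add: R(2)[OF A(1), symmetric] E matrix_mul_assoc)
    finally have QQ: "transpose (Q A) ** Q A = mat 1" .
    \<comment> \<open>The range of \<open>A Q\<^sub>0\<close> lies in that of \<open>A\<close>, so \<open>Q A\<close> is \<open>Q\<^sub>1\<close> times a square matrix \<open>G\<close>.\<close>
    define G where "G = D\<^sub>1 ** transpose Q\<^sub>1 ** Q\<^sub>0 ** E"
    have QG: "Q A = Q\<^sub>1 ** G" unfolding QA G_def by (simp only: Q1(3) matrix_mul_assoc)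
    have "transpose G ** G = mat 1"
      using QQ by (simp add: QG matrix_simps stiefel_cancel[OF Q1(1)])
    then have G: "orthogonal_matrix G" by (simp add: orthogonal_matrix)
    have "\<sigma> A = act (Q\<^sub>1, D\<^sub>1) G"
      unfolding \<sigma>_def QG unfolding Q1(3)
      by (simp add: act_def matrix_simps stiefel_cancel[OF Q1(1)] stiefelD[OF Q1(1)])
    moreover have "(Q\<^sub>1, D\<^sub>1) \<in> total_space" "phi_lift (Q\<^sub>1, D\<^sub>1) = A"
      using Q1 by (auto simp: total_space_def phi_lift_def)
    ultimately show ?thesis using G by (simp add: act_total_space act_phi_lift)
  qed
  ultimately show thesis using that U by blast
qed

lemma smooth_inverse_phi:
  "smooth_into_quot (spsd_rank CARD('k)) (inv_into quot (phi :: ('n::finite, 'k::finite) mat_pair set \<Rightarrow> real^'n^'n))"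
  unfolding smooth_into_quot_def
proof
  fix A\<^sub>0 :: "real^'n^'n" assume "A\<^sub>0 \<in> spsd_rank CARD('k)"
  then obtain U and \<sigma> :: "real^'n^'n \<Rightarrow> ('n, 'k) mat_pair"
    where U: "open U" "A\<^sub>0 \<in> U" "\<And>r. Cr_on r U \<sigma>"
    and \<sigma>: "\<And>A. A \<in> U \<Longrightarrow> A \<in> spsd_rank CARD('k) \<Longrightarrow> \<sigma> A \<in> total_space \<and> phi_lift (\<sigma> A) = A"
    by (rule local_lift) blast
  have "inv_into quot phi A = cls (\<sigma> A)" if "A \<in> U \<inter> spsd_rank CARD('k)" for A
    using \<sigma>[of A] that bij_phi[where 'n = 'n and 'k = 'k]
    by (intro inv_into_f_eq) (auto simp: bij_betw_def quot_eq phi_cls)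
  moreover have "smooth_on (U \<inter> spsd_rank CARD('k)) \<sigma>"
    unfolding smooth_on_def using U(1,3) by blast
  ultimately show "\<exists>U \<sigma>. open U \<and> A\<^sub>0 \<in> U \<and> smooth_on (U \<inter> spsd_rank CARD('k)) \<sigma> \<and>
      (\<forall>t\<in>U \<inter> spsd_rank CARD('k). \<sigma> t \<in> total_space \<and>
        inv_into quot phi t = cls (\<sigma> t :: ('n, 'k) mat_pair))"
    using U(1,2) \<sigma> by (intro exI[of _ U] exI[of _ \<sigma>]) auto
qed

lemma phi_isometry:
  "riemannian_isometry (phi_lift :: ('n::finite, 'k::finite) mat_pair \<Rightarrow> real ^ 'n ^ 'n) pullback_metric
     (spsd_rank CARD('k)) bw_tangent (bw_metric TYPE('k))"
proof -
  have bij: "bij_betw dphi (quot_tangent (cls p)) (bw_tangent (phi (cls p)))"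
    if p: "p \<in> (total_space :: ('n, 'k) mat_pair set)" for p
    unfolding bij_betw_def
  proof
    show "inj_on dphi (quot_tangent (cls p))"
    proof (rule inj_onI)
      fix u v assume uv: "u \<in> quot_tangent (cls p)" "v \<in> quot_tangent (cls p)" "dphi u = dphi v"
      then obtain a b where ab: "a \<in> total_tangent p" "u = tcls p a" "b \<in> total_tangent p" "v = tcls p b"
        unfolding quot_tangent_cls[OF p] by blast
      then have "phi_diff p a = phi_diff p b" using uv(3) by (simp add: dphi_tcls p)
      then show "u = v" using ab by (simp add: tcls_eq p)
    qed
    have "dphi ` quot_tangent (cls p) = phi_diff p ` total_tangent p"
      using p by (auto simp: quot_tangent_cls dphi_tcls image_image)
    then show "dphi ` quot_tangent (cls p) = bw_tangent (phi (cls p))"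
      using p by (simp add: phi_diff_image phi_cls)
  qed
  have "\<forall>x\<in>(quot :: ('n, 'k) mat_pair set set).
        bij_betw dphi (quot_tangent x) (bw_tangent (phi x)) \<and>
        (\<forall>u\<in>quot_tangent x. \<forall>v\<in>quot_tangent x. dphi (tadd u v) = dphi u + dphi v) \<and>
        (\<forall>c. \<forall>u\<in>quot_tangent x. dphi (tscale c u) = c *\<^sub>R dphi u) \<and>
        (\<forall>u\<in>quot_tangent x. \<forall>v\<in>quot_tangent x.
           bw_metric TYPE('k) (phi x) (dphi u) (dphi v) = pullback_metric x u v)"
    using bij by (auto simp: quot_eq quot_tangent_cls dphi_tadd dphi_tscale dphi_tcls pullback_metric_def)
  then show ?thesis
    unfolding riemannian_isometry_def by (intro conjI bij_phi smooth_phi smooth_inverse_phi)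
qed

section \<open>The metric on horizontal vectors\<close>

text \<open>
  For increments orthogonal to the columns of \<open>Q\<close> the mixed terms drop out: the right-hand side of the
  Sylvester equation reduces to the symmetric component, and \<open>1 - Q Q\<^sup>T\<close> acts as the identity.
\<close>

lemma pullback_metric_formula:
  fixes Q :: "real^'k^'n"
  assumes Q: "Q \<in> stiefel" and D: "D \<in> spd_mats" and T: "t \<in> sym_mats" "s \<in> sym_mats"
    and orth: "transpose Q ** x = 0" "transpose Q ** y = 0"
  shows "pullback_metric (cls (Q, D)) (tcls (Q, D) (x, t)) (tcls (Q, D) (y, s))
    = trace (x ** D ** transpose y) + trace (sylvester D t ** D ** sylvester D s)"
proof -
  have orth': "transpose x ** Q = 0" "transpose y ** Q = 0"
    using orth by (metis matrix_transpose_mul transpose_transpose transpose_mat mat_0)+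
  have p: "(Q, D) \<in> total_space" using Q D by (simp add: total_space_def)
  have "D ** transpose x ** Q = 0" "D ** transpose y ** Q = 0"
    using orth' by (metis matrix_mul_assoc matrix_mult.zero_right)+
  moreover have "(mat 1 - Q ** transpose Q) ** x = x"
    by (simp add: matrix_simps) (metis orth(1) matrix_mul_assoc matrix_mult.zero_right)
  ultimately have "lifted_metric (Q, D) (x, t) (y, s)
      = trace (x ** D ** transpose y) + trace (sylvester D t ** D ** sylvester D s)"
    by (simp add: lifted_metric_def Let_def orth)
  moreover have "(x, t) \<in> total_tangent (Q, D)" "(y, s) \<in> total_tangent (Q, D)"
    using orth orth' T by (simp_all add: total_tangent_def)
  ultimately show ?thesis
    using p by (simp add: pullback_metric_tcls bw_metric_phi_diff)
qed

lemma orthogonal_hcat: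
  assumes "orthogonal_mat2 (hcat Q Q')" shows "transpose Q ** Q' = 0"
proof -
  have "(transpose Q ** Q') $ i $ j = (transpose (hcat Q Q') ** hcat Q Q') $ Inl i $ Inr j" for i j
    by (simp add: matrix_matrix_mult_def transpose_def hcat_def)
  also have "\<dots> i j = 0" for i j
    using assms by (simp add: orthogonal_mat2_def mat_def)
  finally show ?thesis by (simp add: vec_eq_iff)
qed

(* The first conjunct is the formula for k < n, with n - k = CARD('m); the second one is the case
   k = n, where Q_perp, B_V and B_W are empty, which no index type can express. *)
theorem proposition4:
  assumes "CARD('k::finite) \<le> CARD('n::finite)"
  shows
    "(\<forall>(Q :: real ^ 'k ^ 'n) (Qp :: real ^ 'm ^ 'n) D BV BW TV TW.
        CARD('n) = CARD('k) + CARD('m) \<longrightarrow>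
        Q \<in> stiefel \<longrightarrow> D \<in> spd_mats \<longrightarrow> Qp \<in> stiefel \<longrightarrow> orthogonal_mat2 (hcat Q Qp) \<longrightarrow>
        TV \<in> sym_mats \<longrightarrow> TW \<in> sym_mats \<longrightarrow>
        pullback_metric (cls (Q, D)) (tcls (Q, D) (Qp ** BV, TV)) (tcls (Q, D) (Qp ** BW, TW)) =
          trace (BV ** D ** transpose BW) + trace (sylvester D TV ** D ** sylvester D TW))
     \<and>
     (\<forall>(Q :: real ^ 'k ^ 'n) D TV TW.
        CARD('n) = CARD('k) \<longrightarrow>
        Q \<in> stiefel \<longrightarrow> D \<in> spd_mats \<longrightarrow> TV \<in> sym_mats \<longrightarrow> TW \<in> sym_mats \<longrightarrow>
        pullback_metric (cls (Q, D)) (tcls (Q, D) (0, TV)) (tcls (Q, D) (0, TW)) =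
          trace (sylvester D TV ** D ** sylvester D TW))
     \<and>
     (\<forall>p \<in> (total_space :: ('n, 'k) mat_pair set). \<forall>a \<in> total_tangent p. \<forall>b \<in> total_tangent p.
        pullback_metric (cls p) (tcls p a) (tcls p b) =
          bw_metric TYPE('k) (phi_lift p)
            (frechet_derivative phi_lift (at p) a) (frechet_derivative phi_lift (at p) b))
     \<and>
     (\<forall>(G :: real ^ 'k ^ 'k) D (BV :: real ^ 'k ^ 'm) BW TV TW.
        orthogonal_matrix G \<longrightarrow> D \<in> spd_mats \<longrightarrow> TV \<in> sym_mats \<longrightarrow> TW \<in> sym_mats \<longrightarrow>
        (let D' = transpose G ** D ** G; BV' = BV ** G; BW' = BW ** G;
             TV' = transpose G ** TV ** G; TW' = transpose G ** TW ** G
         in trace (BV' ** D' ** transpose BW') + trace (sylvester D' TV' ** D' ** sylvester D' TW') =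
            trace (BV ** D ** transpose BW) + trace (sylvester D TV ** D ** sylvester D TW)))
     \<and> riemannian_metric_on_quot (pullback_metric :: ('n, 'k) mat_pair set \<Rightarrow> _)
     \<and> riemannian_isometry (phi_lift :: ('n, 'k) mat_pair \<Rightarrow> real ^ 'n ^ 'n) pullback_metric
         (spsd_rank CARD('k)) bw_tangent (bw_metric TYPE('k))"
  (is "?formula \<and> ?full_rank \<and> ?pullback \<and> ?invariant \<and> ?metric \<and> ?isometry")
proof (intro conjI)
  show ?formula
  proof (intro allI impI)
    fix Q :: "real^'k^'n" and Qp :: "real^'m^'n" and D TV TW :: "real^'k^'k" and BV BW :: "real^'k^'m"
    assume Q: "Q \<in> stiefel" "D \<in> spd_mats" and Qp: "Qp \<in> stiefel" and orth: "orthogonal_mat2 (hcat Q Qp)"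
      and T: "TV \<in> sym_mats" "TW \<in> sym_mats"
    have QQp: "transpose Q ** (Qp ** B) = 0" for B :: "real^'k^'m"
      using orthogonal_hcat[OF orth] by (simp add: matrix_mul_assoc)
    have "trace (Qp ** BV ** D ** transpose (Qp ** BW))
        = trace (Qp ** (BV ** D ** transpose BW ** transpose Qp))"
      by (simp add: matrix_simps)
    also have "\<dots> = trace (BV ** D ** transpose BW)"
      by (subst trace_mul_sym) (simp only: stiefel_cancel[OF Qp])
    finally show "pullback_metric (cls (Q, D)) (tcls (Q, D) (Qp ** BV, TV)) (tcls (Q, D) (Qp ** BW, TW)) =
          trace (BV ** D ** transpose BW) + trace (sylvester D TV ** D ** sylvester D TW)"
      by (simp add: pullback_metric_formula Q T QQp)
  qed
  show ?full_rank
    by (intro allI impI) (simp add: pullback_metric_formula trace_def)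
  show ?pullback
    by (simp add: pullback_metric_tcls frechet_derivative_phi_lift)
  show ?invariant
  proof (intro allI impI)
    fix G D TV TW :: "real^'k^'k" and BV BW :: "real^'k^'m"
    assume G: "orthogonal_matrix G" and D: "D \<in> spd_mats"
    have "trace (transpose G ** sylvester D TV ** D ** sylvester D TW ** G)
        = trace (G ** (transpose G ** sylvester D TV ** D ** sylvester D TW))"
      by (subst (2) trace_mul_sym) (simp only: matrix_mul_assoc)
    also have "\<dots> = trace (sylvester D TV ** D ** sylvester D TW)"
      by (simp add: matrix_mul_assoc orthogonal_matrixD[OF G])
    finally show "let D' = transpose G ** D ** G; BV' = BV ** G; BW' = BW ** G;
             TV' = transpose G ** TV ** G; TW' = transpose G ** TW ** G
         in trace (BV' ** D' ** transpose BW') + trace (sylvester D' TV' ** D' ** sylvester D' TW') =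
            trace (BV ** D ** transpose BW) + trace (sylvester D TV ** D ** sylvester D TW)"
      by (simp add: Let_def sylvester_conjugate[OF D G] matrix_simps orthogonal_cancel[OF G])
  qed
  show ?metric by (rule pullback_riemannian_metric)
  show ?isometry by (rule phi_isometry)
qed

end
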